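(* For every integer $n\geq 1$, $$\int_0^{\pi/4}\frac{\sin(4nx)}{\ln(\tan x)}\,dx=\frac{(-1)^n}{2}\sum_{p=1}^{n}(2^{2p+1}-1)\Bigl([x]\,U_{2n-1}\!\left(\tfrac1x\right)(\arcsin x)^{2p}\Bigr)\frac{\zeta(2p+1)}{\pi^{2p}},$$ and $$\int_0^{\pi/4}\frac{\cos((4n-2)x)}{\ln(\tan x)}\,dx=(-1)^n\sum_{p=1}^{n}2^{2p-1}\Bigl([x]\,U_{2n-2}\!\left(\tfrac1x\right)(\arcsin x)^{2p-1}\Bigr)\frac{\beta(2p)}{\pi^{2p-1}}.$$
   Context: $U_m$ is the Chebyshev polynomial of the second kind, normalized by $U_m(\cos\theta)=\frac{\sin((m+1)\theta)}{\sin\theta}$. $\zeta$ is the Riemann zeta function and $\beta$ is the Dirichlet beta function, $\beta(s)=\sum_{r\ge0}(-1)^r(2r+1)^{-s}$. For a Laurent series $F$, $[x]F(x)$ denotes the coefficient of $x^1$ in the Laurent expansion of $F$ at $x=0$; $\arcsin$ is the principal branch. *)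

theory Defs
  imports "HOL-Complex_Analysis.Complex_Analysis"
begin

definition cheb_U :: "nat \<Rightarrow> complex poly" where
  "cheb_U m = (THE p. \<forall>\<theta>. sin \<theta> \<noteq> 0 \<longrightarrow>
     poly p (cos \<theta>) = sin (of_nat (m + 1) * \<theta>) / sin \<theta>)"

lemma cheb_U_unique:
  fixes p q :: "complex poly"
  assumes "\<And>\<theta>. sin \<theta> \<noteq> 0 \<Longrightarrow> poly p (cos \<theta>) = poly q (cos \<theta>)"
  shows "p = q"
proof -
  have "poly (p - q) z = 0" if "z \<notin> {1, -1}" for z
  proof -
    have "sin (Arccos z) \<noteq> 0"
    proof
      assume "sin (Arccos z) = 0"
      then have "z\<^sup>2 = 1"
        using sin_cos_squared_add[of "Arccos z"] by simp
      with that show False by (auto simp: power2_eq_1_iff)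
    qed
    from assms[OF this] show ?thesis by simp
  qed
  then have "- {1, -1} \<subseteq> {z. poly (p - q) z = 0}" by auto
  moreover have "infinite (- {1, -1 :: complex})"
    by (simp add: finite_compl infinite_UNIV_char_0)
  ultimately have "p - q = 0"
    using poly_roots_finite infinite_super by blast
  then show ?thesis by simp
qed

lemma cheb_U_exists:
  "\<exists>p :: complex poly. \<forall>\<theta>. sin \<theta> \<noteq> 0 \<longrightarrow>
     poly p (cos \<theta>) = sin (of_nat (m + 1) * \<theta>) / sin \<theta>"
proof (induction m rule: less_induct)
  case (less m)
  consider "m = 0" | "m = 1" | k where "m = Suc (Suc k)"
    by (metis One_nat_def not0_implies_Suc)
  then show ?case
  proof cases
    case 1
    then show ?thesis by (intro exI[of _ 1]) simp
  next
    case 2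
    moreover have "sin (\<theta> * 2) = 2 * sin \<theta> * cos \<theta>" for \<theta> :: complex
      by (metis sin_double mult.commute)
    ultimately show ?thesis by (intro exI[of _ "[:0, 2:]"]) (simp add: mult_ac)
  next
    case (3 k)
    obtain p where p: "\<And>\<theta>. sin \<theta> \<noteq> 0 \<Longrightarrow>
        poly p (cos \<theta>) = sin (of_nat (k + 1) * \<theta>) / sin (\<theta> :: complex)"
      using less.IH[of k] 3 by auto
    obtain q where q: "\<And>\<theta>. sin \<theta> \<noteq> 0 \<Longrightarrow>
        poly q (cos \<theta>) = sin (of_nat (Suc k + 1) * \<theta>) / sin (\<theta> :: complex)"
      using less.IH[of "Suc k"] 3 by auto
    have "poly ([:0, 2:] * q - p) (cos \<theta>) = sin (of_nat (m + 1) * \<theta>) / sin \<theta>"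
      if "sin \<theta> \<noteq> 0" for \<theta> :: complex
    proof -
      define t where "t = of_nat (Suc k + 1) * \<theta>"
      have "of_nat (k + 1) * \<theta> = t - \<theta>" "of_nat (m + 1) * \<theta> = t + \<theta>"
        using 3 by (simp_all add: t_def algebra_simps)
      then have "poly p (cos \<theta>) = sin (t - \<theta>) / sin \<theta>"
        "poly q (cos \<theta>) = sin t / sin \<theta>"
        and m: "sin (of_nat (m + 1) * \<theta>) = sin (t + \<theta>)"
        using p[OF that] q[OF that] by (simp_all only: t_def)
      then have "poly ([:0, 2:] * q - p) (cos \<theta>) =
          (2 * cos \<theta> * sin t - sin (t - \<theta>)) / sin \<theta>"
        by (simp add: diff_divide_distrib)
      also have "2 * cos \<theta> * sin t - sin (t - \<theta>) = sin (t + \<theta>)"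
        by (simp add: sin_add sin_diff)
      finally show ?thesis by (simp only: m)
    qed
    then show ?thesis by blast
  qed
qed

lemma poly_cheb_U_cos:
  assumes "sin \<theta> \<noteq> 0"
  shows "poly (cheb_U m) (cos \<theta>) = sin (of_nat (m + 1) * \<theta>) / sin \<theta>"
proof -
  have "\<exists>!p :: complex poly. \<forall>\<theta>. sin \<theta> \<noteq> 0 \<longrightarrow>
      poly p (cos \<theta>) = sin (of_nat (m + 1) * \<theta>) / sin \<theta>"
    using cheb_U_exists[of m] by (auto intro!: cheb_U_unique)
  from theI'[OF this] assms show ?thesis by (simp add: cheb_U_def)
qed

(* The Dirichlet series: this is the Riemann zeta function for Re s > 1 only. *)
definition zeta :: "complex \<Rightarrow> complex" where
  "zeta s = (\<Sum>k. 1 / of_nat (k + 1) powr s)"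

(* The Dirichlet beta function, for Re s > 0. *)
definition dirichlet_beta :: "complex \<Rightarrow> complex" where
  "dirichlet_beta s = (\<Sum>r. (-1) ^ r / of_nat (2 * r + 1) powr s)"

definition laurent_coeff_x :: "(complex \<Rightarrow> complex) \<Rightarrow> complex" where
  "laurent_coeff_x F = fls_nth (laurent_expansion F 0) 1"

end

(*
  With u = - ln (tan x) both integrals become multiples of the integral over u > 0 of
  tanh u * U_m (sech u) * sech u / u, where m = 2n - 1 or m = 2n - 2; up to a factor i the
  numerator is G (pi/2 + iu) for G z = U_m (1 / sin z) * cos z / (sin z)^2. This G is a finite
  combination of the Eisenstein-type sums over k of eps^k / (z - k pi)^j with eps = 1 or -1,
  and its coefficients are residues at 0, which the substitution x = sin z turns into the
  coefficients [x] U_m (1/x) (arcsin x)^p. Integrating the sums term by term yields the zeta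
  and beta values.
*)
theory Submission
  imports Defs
begin

text \<open>Matching principal parts would leave an unknown entire remainder in the expansion of G.
  Only exact identities are used instead: the reflection formula of Gamma gives closed forms for the
  sums of order 2, and differentiating twice raises the order by two. As U_m has the parity of m,
  the powers of 1 / sin z in G all have one parity, so each formula needs one family of sums: odd
  orders from 3 on with eps = 1 for m = 2n - 1, even orders from 2 on with eps = -1 for m = 2n - 2.
  The coefficients are first only known to exist and are identified afterwards by residues. Parity
  also tames the factor 1/u: pi/2 is the midpoint of the poles -k pi and (k+1) pi, and in both cases
  their contributions at pi/2 + iu combine to a difference that is odd in u and so vanishes at u =
  0. Up to a power of i, a pair at distance b integrates to pi / b^j. With b = pi (k + 1/2) the sum
  over k is pi (2^j - 1) zeta(j) / pi^j for odd j and pi 2^j beta(j) / pi^j for even j, whence the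
  powers of 2 and pi in the theorem.\<close>

subsection \<open>Periodic and antiperiodic pole sums\<close>

text \<open>\<open>per_pole m z\<close> and \<open>alt_pole m z\<close> are the sums of \<open>1 / (z - k \<pi>)\<^sup>m\<close> and
  \<open>(-1)\<^sup>k / (z - k \<pi>)\<^sup>m\<close> over all integers \<open>k\<close> (absolutely convergent for \<open>m \<ge> 2\<close>).\<close>

definition per_pole :: "nat \<Rightarrow> complex \<Rightarrow> complex" where
  "per_pole m z = ((-1) ^ m * Polygamma (m - 1) (z / of_real pi)
     + Polygamma (m - 1) (1 - z / of_real pi)) / (fact (m - 1) * of_real pi ^ m)"

definition alt_pole :: "nat \<Rightarrow> complex \<Rightarrow> complex" where
  "alt_pole m z = (per_pole m (z / 2) - per_pole m (z / 2 + of_real pi / 2)) / 2 ^ m"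

lemma sin_nonzero_not_Ints:
  fixes z :: complex
  assumes "sin z \<noteq> 0"
  shows "z / of_real pi \<notin> \<int>" "1 - z / of_real pi \<notin> \<int>"
proof -
  show *: "z / of_real pi \<notin> \<int>"
  proof
    assume "z / of_real pi \<in> \<int>"
    then obtain k where "z / of_real pi = of_int k" by (elim Ints_cases)
    then have "z = of_real (real_of_int k * pi)" by (simp add: field_simps)
    with assms show False by (metis sin_eq_0)
  qed
  show "1 - z / of_real pi \<notin> \<int>"
    using * Ints_diff[of 1 "1 - z / of_real pi"] by auto
qed

lemma sin_nonzero_half:
  fixes z :: complex
  assumes "sin z \<noteq> 0"
  shows "sin (z / 2) \<noteq> 0" "sin (z / 2 + of_real pi / 2) \<noteq> 0"
proof -
  have "sin z = 2 * sin (z / 2) * cos (z / 2)"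
    using sin_double[of "z / 2"] by simp
  with assms show "sin (z / 2) \<noteq> 0" "sin (z / 2 + of_real pi / 2) \<noteq> 0"
    by (auto simp: sin_add)
qed

text \<open>With t = z / pi, the Polygamma series at t collects the poles -k pi and the one at 1 - t
  the poles (k+1) pi. Since z - (k+1) pi = - pi (1 - t + k), the second series carries an extra sign
  (-1)^m.\<close>

lemma per_pole_sums:
  assumes "sin z \<noteq> 0" and "m \<ge> 2"
  shows "(\<lambda>k. 1 / (z + of_nat k * of_real pi) ^ m + 1 / (z - of_nat (Suc k) * of_real pi) ^ m)
           sums per_pole m z"
proof -
  define t where "t = z / of_real pi"
  have z: "z = t * of_real pi" by (simp add: t_def)
  have nz: "t \<noteq> 0" "1 - t \<noteq> 0"
    using sin_nonzero_not_Ints[OF assms(1)] unfolding t_def by (metis Ints_0)+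
  define j where "j = m - 1"
  have m: "m = Suc j" "j > 0" using assms(2) by (auto simp: j_def)
  have "(\<lambda>k. (inverse ((t + of_nat k) ^ Suc j) + (-1) ^ Suc j * inverse ((1 - t + of_nat k) ^ Suc j)) /
          of_real pi ^ m)
        sums (((-1) ^ Suc j * Polygamma j t / fact j +
               (-1) ^ Suc j * ((-1) ^ Suc j * Polygamma j (1 - t) / fact j)) / of_real pi ^ m)"
    using nz m by (intro sums_divide sums_add sums_mult Polygamma_LIMSEQ)
  also have "(((-1) ^ Suc j * Polygamma j t / fact j +
       (-1) ^ Suc j * ((-1) ^ Suc j * Polygamma j (1 - t) / fact j)) / of_real pi ^ m) = per_pole m z"
    unfolding per_pole_def m t_def[symmetric]
    by (simp add: add_divide_distrib diff_divide_distrib mult.commute flip: power_add mult_2)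
  also have "(\<lambda>k. (inverse ((t + of_nat k) ^ Suc j) +
        (-1) ^ Suc j * inverse ((1 - t + of_nat k) ^ Suc j)) / of_real pi ^ m) =
      (\<lambda>k. 1 / (z + of_nat k * of_real pi) ^ m + 1 / (z - of_nat (Suc k) * of_real pi) ^ m)"
  proof
    fix k
    have 1: "(z + of_nat k * of_real pi) ^ m = (t + of_nat k) ^ m * of_real pi ^ m"
      by (simp add: z power_mult_distrib flip: distrib_right)
    have "z - of_nat (Suc k) * of_real pi = - (1 - t + of_nat k) * of_real pi"
      by (simp add: z algebra_simps)
    then have 2: "(z - of_nat (Suc k) * of_real pi) ^ m =
        (-1) ^ m * (1 - t + of_nat k) ^ m * of_real pi ^ m"
      by (metis power_minus power_mult_distrib)
    have 3: "1 / ((-1) ^ m * x) = (-1) ^ m * inverse x" for x :: complex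
      by (cases "even m") (auto simp: field_simps)
    show "(inverse ((t + of_nat k) ^ Suc j) +
        (-1) ^ Suc j * inverse ((1 - t + of_nat k) ^ Suc j)) / of_real pi ^ m =
      1 / (z + of_nat k * of_real pi) ^ m + 1 / (z - of_nat (Suc k) * of_real pi) ^ m"
      unfolding 1 2 3 mult.assoc m(1)[symmetric] by (simp add: field_simps)
  qed
  finally show ?thesis .
qed

lemma has_field_derivative_per_pole:
  assumes "sin z \<noteq> 0" and "m \<ge> 1"
  shows "(per_pole m has_field_derivative - of_nat m * per_pole (Suc m) z) (at z)"
proof -
  obtain j where m: "m = Suc j" using assms(2) by (cases m) auto
  have ni: "z / of_real pi \<notin> \<int>\<^sub>\<le>\<^sub>0" "1 - z / of_real pi \<notin> \<int>\<^sub>\<le>\<^sub>0"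
    using sin_nonzero_not_Ints[OF assms(1)] nonpos_Ints_subset_Ints by auto
  define c :: complex where "c = of_nat (Suc j)"
  have c: "c \<noteq> 0" by (simp add: c_def del: of_nat_Suc)
  have "(per_pole m has_field_derivative
      ((-1) ^ m * (Polygamma (Suc j) (z / of_real pi) * (1 / of_real pi)) +
       Polygamma (Suc j) (1 - z / of_real pi) * - (1 / of_real pi)) /
        (fact (m - 1) * of_real pi ^ m)) (at z)"
    unfolding per_pole_def by (rule derivative_eq_intros refl ni | simp add: m)+
  also have "((-1) ^ m * (Polygamma (Suc j) (z / of_real pi) * (1 / of_real pi)) +
       Polygamma (Suc j) (1 - z / of_real pi) * - (1 / of_real pi)) /
        (fact (m - 1) * of_real pi ^ m) = - of_nat m * per_pole (Suc m) z"
  proof -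
    have alg: "((-1) ^ m * (A * (1 / p)) + B * - (1 / p)) / (f * q) =
        - c * (((-1) ^ Suc m * A + B) / (c * f * (p * q)))" if "p \<noteq> 0" for A B f p q :: complex
      using that c by (simp add: divide_simps)
    have "fact j * c = fact (Suc j)" by (simp add: c_def)
    then show ?thesis
      using alg[of "of_real pi"] unfolding per_pole_def by (simp add: m c_def del: of_nat_Suc)
  qed
  finally show ?thesis .
qed

lemma has_field_derivative_alt_pole:
  assumes "sin z \<noteq> 0" and "m \<ge> 1"
  shows "(alt_pole m has_field_derivative - of_nat m * alt_pole (Suc m) z) (at z)"
proof -
  note D = DERIV_chain2[OF has_field_derivative_per_pole[OF _ assms(2)]]
  show ?thesis unfolding alt_pole_def
    by (rule derivative_eq_intros D sin_nonzero_half assms refl | simp)+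
       (simp add: field_simps)
qed

text \<open>Gamma t * Gamma (1 - t) * sin z with t = z / pi is the constant pi. Its logarithmic
  derivative gives \<open>f\<close> = 0, the reflection formula of Digamma, and differentiating
  \<open>f\<close> once more gives the claim.\<close>

lemma per_pole_2:
  assumes "sin z \<noteq> 0"
  shows "per_pole 2 z = 1 / sin z ^ 2"
proof -
  define f where "f = (\<lambda>z::complex. Digamma (z / of_real pi) - Digamma (1 - z / of_real pi) + of_real pi * cot z)"
  have ni: "z / of_real pi \<notin> \<int>\<^sub>\<le>\<^sub>0" "1 - z / of_real pi \<notin> \<int>\<^sub>\<le>\<^sub>0" if "sin z \<noteq> 0" for z :: complex
    using sin_nonzero_not_Ints[OF that] nonpos_Ints_subset_Ints by auto
  have X: "open {z::complex. sin z \<noteq> 0}"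
    by (intro open_Collect_neq continuous_intros)
  have f0: "f z = 0" if z: "sin z \<noteq> 0" for z
  proof -
    define G where "G = (\<lambda>z::complex. Gamma (z / of_real pi) * Gamma (1 - z / of_real pi) * sin z)"
    have G_eq: "of_real pi = G w" if "w \<in> {z. sin z \<noteq> 0}" for w
      using Gamma_reflection_complex[of "w / of_real pi"] that by (simp add: G_def)
    have G0: "(G has_field_derivative 0) (at z)"
      by (rule has_field_derivative_transform_within_open[OF DERIV_const X _ G_eq]) (use z in auto)
    have "(G has_field_derivative
        (Gamma (z / of_real pi) * Digamma (z / of_real pi) * (1 / of_real pi) * Gamma (1 - z / of_real pi)
         + Gamma (1 - z / of_real pi) * Digamma (1 - z / of_real pi) * - (1 / of_real pi) * Gamma (z / of_real pi))
          * sin z + cos z * (Gamma (z / of_real pi) * Gamma (1 - z / of_real pi))) (at z)"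
      unfolding G_def using z by - (rule derivative_eq_intros refl ni | simp)+
    moreover have "(a * b * (1 / p) * c + c * d * - (1 / p) * a) * s + k * (a * c) =
        a * c * s / p * (b - d + p * (k / s))" if "s \<noteq> 0" "p \<noteq> 0" for a b c d k p s :: complex
      using that by (simp add: divide_simps) (simp add: algebra_simps)
    ultimately have "(G has_field_derivative G z / of_real pi * f z) (at z)"
      using z by (simp add: G_def f_def cot_def)
    with G0 have "G z / of_real pi * f z = 0" by (metis DERIV_unique)
    moreover have "G z = of_real pi" using G_eq[of z] z by simp
    ultimately show ?thesis by simp
  qed
  have "(f has_field_derivative 0) (at z)"
    by (rule has_field_derivative_transform_within_open[OF DERIV_const X, of z 0]) (use assms f0 in auto)
  moreover have "(f has_field_derivative
      Polygamma 1 (z / of_real pi) * (1 / of_real pi)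
        - Polygamma 1 (1 - z / of_real pi) * - (1 / of_real pi)
        + of_real pi * - inverse (sin z ^ 2)) (at z)"
    unfolding f_def using DERIV_cot[OF assms]
    by - (rule derivative_eq_intros refl ni assms | assumption | simp)+
  moreover have "Polygamma 1 (z / of_real pi) * (1 / of_real pi)
        - Polygamma 1 (1 - z / of_real pi) * - (1 / of_real pi)
        + of_real pi * - inverse (sin z ^ 2) = of_real pi * (per_pole 2 z - 1 / sin z ^ 2)"
    by (simp add: per_pole_def power2_eq_square inverse_eq_divide diff_divide_distrib
          add_divide_distrib algebra_simps)
  ultimately have "of_real pi * (per_pole 2 z - 1 / sin z ^ 2) = 0" by (metis DERIV_unique)
  then show ?thesis by simp
qed

text \<open>In \<open>alt_pole\<close> the even k come from \<open>per_pole\<close> at z/2 and the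
  odd k from z/2 + pi/2. For order 2 and w = z/2 this leaves (1 / sin^2 w - 1 / cos^2 w) / 4, to
  which the double-angle formulas apply.\<close>

lemma alt_pole_2:
  assumes "sin z \<noteq> 0"
  shows "alt_pole 2 z = cos z / sin z ^ 2"
proof -
  define w where "w = z / 2"
  have z: "z = 2 * w" by (simp add: w_def)
  have nz: "sin w \<noteq> 0" "sin (w + of_real pi / 2) \<noteq> 0"
    using sin_nonzero_half[OF assms] by (simp_all add: w_def)
  have c: "sin (w + of_real pi / 2) = cos w"
    by (simp add: sin_add)
  have alg: "(1 / a ^ 2 - 1 / b ^ 2) / 2 ^ 2 = (b ^ 2 - a ^ 2) / (2 * a * b) ^ 2"
    if "a \<noteq> 0" "b \<noteq> 0" for a b :: complex
    using that by (simp add: divide_simps power_mult_distrib)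
  have "alt_pole 2 z = (cos w ^ 2 - sin w ^ 2) / (2 * sin w * cos w) ^ 2"
    unfolding alt_pole_def w_def[symmetric] per_pole_2[OF nz(1)] per_pole_2[OF nz(2)] c
    using nz c by (intro alg) simp_all
  then show ?thesis
    by (simp only: z sin_double cos_double)
qed

text \<open>Near 0 only Polygamma at z / pi is singular. Its recurrence moves the argument to z / pi
  + 1, and the correction is exactly 1 / z^m.\<close>

lemma per_pole_near_0:
  assumes "m \<ge> 1"
  obtains g :: "complex \<Rightarrow> complex" where "g analytic_on {0}" "\<And>z. sin z \<noteq> 0 \<Longrightarrow> per_pole m z = 1 / z ^ m + g z"
proof
  define g :: "complex \<Rightarrow> complex" where "g = (\<lambda>z. ((-1) ^ m * Polygamma (m - 1) (z / of_real pi + 1)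
     + Polygamma (m - 1) (1 - z / of_real pi)) / (fact (m - 1) * of_real pi ^ m))"
  show "g analytic_on {0}" unfolding g_def
    by (intro analytic_intros) auto
  fix z :: complex assume "sin z \<noteq> 0"
  then have nz: "z / of_real pi \<noteq> 0"
    using sin_nonzero_not_Ints[of z] by (metis Ints_0)
  obtain j where m: "m = Suc j" using assms by (cases m) auto
  have "(-1) ^ m * Polygamma (m - 1) (z / of_real pi) =
      (-1) ^ m * Polygamma (m - 1) (z / of_real pi + 1) + fact j * of_real pi ^ m / z ^ m"
    unfolding Polygamma_plus1[OF nz] m
    by (cases "even j") (simp_all add: power_divide distrib_left)
  then show "per_pole m z = 1 / z ^ m + g z"
    unfolding per_pole_def g_def by (simp only: add_divide_distrib) (simp add: m)
qed

lemma alt_pole_near_0: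
  assumes "m \<ge> 1"
  obtains g :: "complex \<Rightarrow> complex" where "g analytic_on {0}" "\<And>z. sin z \<noteq> 0 \<Longrightarrow> alt_pole m z = 1 / z ^ m + g z"
proof -
  obtain h where h: "h analytic_on {0}" "\<And>z. sin z \<noteq> 0 \<Longrightarrow> per_pole m z = 1 / z ^ m + h z"
    using per_pole_near_0[OF assms] by blast
  define g where "g = (\<lambda>z::complex. (h (z / 2) - per_pole m (z / 2 + of_real pi / 2)) / 2 ^ m)"
  show thesis
  proof (rule that[of g])
    have 1: "(\<lambda>z. h (z / 2)) analytic_on {0}"
      using h(1) by (intro analytic_on_compose_gen[of "\<lambda>z. z / 2" _ h "{0}", unfolded o_def])
        (auto intro!: analytic_intros)
    \<comment> \<open>At z = 0 both Polygamma arguments of the shifted sum equal 1/2, so the odd k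
      contribute no pole.\<close>
    have "1 / 2 \<notin> (\<int> :: complex set)" using fraction_not_in_Ints[of 2 1] by simp
    then have "1 / 2 \<notin> (\<int>\<^sub>\<le>\<^sub>0 :: complex set)" using nonpos_Ints_subset_Ints by blast
    then have 2: "(\<lambda>z. per_pole m (z / 2 + of_real pi / 2)) analytic_on {0}"
      unfolding per_pole_def by (intro analytic_intros) auto
    show "g analytic_on {0}" unfolding g_def
      by (intro analytic_intros 1 2) auto
    show "alt_pole m z = 1 / z ^ m + g z" if "sin z \<noteq> 0" for z
      unfolding alt_pole_def h(2)[OF sin_nonzero_half(1)[OF that]] g_def
      by (simp add: add_divide_distrib diff_divide_distrib power_divide)
  qed
qed

subsection \<open>Pole expansion of the Chebyshev factor\<close>

text \<open>Serves to differentiate an identity that holds on an open set.\<close>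

lemma DERIV_unique_on_open:
  fixes f g :: "complex \<Rightarrow> complex"
  assumes "open X" "z \<in> X" "\<And>w. w \<in> X \<Longrightarrow> f w = g w"
    and "(f has_field_derivative f') (at z)" "(g has_field_derivative g') (at z)"
  shows "f' = g'"
  using has_field_derivative_transform_within_open[OF assms(4,1,2,3)] assms(5) DERIV_unique by blast

text \<open>Orders advance by two because parity is preserved throughout. The coefficients stay
  existential: their values are recovered from the expansion itself in
  \<open>laurent_coeff_x_pole_expansion\<close>.\<close>

definition pole_span :: "(nat \<Rightarrow> complex \<Rightarrow> complex) \<Rightarrow> nat \<Rightarrow> nat \<Rightarrow> (complex \<Rightarrow> complex) \<Rightarrow> bool" where
  "pole_span P s q f \<longleftrightarrow> (\<exists>c. \<forall>z. sin z \<noteq> 0 \<longrightarrow> f z = (\<Sum>i\<le>q. c i * P (s + 2 * i) z))"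

lemma pole_span_mono:
  assumes "pole_span P s q f" "q \<le> q'"
  shows "pole_span P s q' f"
proof -
  obtain c where c: "\<And>z. sin z \<noteq> 0 \<Longrightarrow> f z = (\<Sum>i\<le>q. c i * P (s + 2 * i) z)"
    using assms(1) by (auto simp: pole_span_def)
  have "f z = (\<Sum>i\<le>q'. (if i \<le> q then c i else 0) * P (s + 2 * i) z)" if "sin z \<noteq> 0" for z
    unfolding c[OF that] using assms(2) by (intro sum.mono_neutral_cong_left) auto
  then show ?thesis by (auto simp: pole_span_def intro!: exI[of _ "\<lambda>i. if i \<le> q then c i else 0"])
qed

lemma pole_span_sum:
  assumes "\<And>a. a \<in> A \<Longrightarrow> pole_span P s q (f a)"
  shows "pole_span P s q (\<lambda>z. \<Sum>a\<in>A. k a * f a z)"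
proof -
  have "\<forall>a\<in>A. \<exists>c. \<forall>z. sin z \<noteq> 0 \<longrightarrow> f a z = (\<Sum>i\<le>q. c i * P (s + 2 * i) z)"
    using assms by (simp add: pole_span_def)
  from bchoice[OF this] obtain c where
    c: "\<And>a z. a \<in> A \<Longrightarrow> sin z \<noteq> 0 \<Longrightarrow> f a z = (\<Sum>i\<le>q. c a i * P (s + 2 * i) z)"
    by blast
  have "(\<Sum>a\<in>A. k a * f a z) = (\<Sum>i\<le>q. (\<Sum>a\<in>A. k a * c a i) * P (s + 2 * i) z)"
    if "sin z \<noteq> 0" for z
  proof -
    have "(\<Sum>a\<in>A. k a * f a z) = (\<Sum>a\<in>A. \<Sum>i\<le>q. k a * c a i * P (s + 2 * i) z)"
      using that by (intro sum.cong) (auto simp: c sum_distrib_left mult.assoc)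
    then show ?thesis by (simp add: sum_distrib_right sum.swap[of _ _ A])
  qed
  then show ?thesis unfolding pole_span_def by (intro exI[of _ "\<lambda>i. \<Sum>a\<in>A. k a * c a i"]) blast
qed

text \<open>The functions \<open>h\<^sub>r = cos / sin ^ (r + 1)\<close> satisfy
  \<open>h\<^sub>r'' = (r + 1) (r + 2) h\<^bsub>r+2\<^esub> - r\<^sup>2 h\<^sub>r\<close>, so differentiating an expansion
  of \<open>h\<^sub>r\<close> twice yields one of \<open>h\<^bsub>r+2\<^esub>\<close>.\<close>

lemma pole_span_cos_over_sin_power:
  assumes D: "\<And>m z. m \<ge> 1 \<Longrightarrow> sin z \<noteq> 0 \<Longrightarrow>
      (P m has_field_derivative - of_nat m * P (Suc m) z) (at z)"
    and base: "\<And>z. sin z \<noteq> 0 \<Longrightarrow> P s z = cos z / sin z ^ s"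
    and s: "s \<ge> 2"
  shows "pole_span P s q (\<lambda>z. cos z / sin z ^ (s + 2 * q))"
proof (induction q)
  case 0
  then show ?case using base by (auto simp: pole_span_def intro!: exI[of _ "\<lambda>_. 1"])
next
  case (Suc q)
  define r where "r = s + 2 * q - 1"
  have r: "s + 2 * q = r + 1" "r \<ge> 1" using s by (auto simp: r_def)
  define X where "X = {z::complex. sin z \<noteq> 0}"
  have X: "open X" unfolding X_def by (intro open_Collect_neq continuous_intros)
  obtain c where c: "\<And>z. z \<in> X \<Longrightarrow> cos z / sin z ^ (r + 1) = (\<Sum>i\<le>q. c i * P (s + 2 * i) z)"
    using Suc.IH by (auto simp: pole_span_def r X_def)
  have d1: "of_nat r / sin z ^ r - of_nat (r + 1) / sin z ^ (r + 2) =
      (\<Sum>i\<le>q. c i * (- of_nat (s + 2 * i) * P (Suc (s + 2 * i)) z))" if z: "z \<in> X" for z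
  proof (rule DERIV_unique_on_open[OF X z c])
    have nz: "sin z \<noteq> 0" using z by (simp add: X_def)
    have "((\<lambda>z. cos z / sin z ^ (r + 1)) has_field_derivative
        (- sin z * sin z ^ (r + 1) - cos z * (of_nat (r + 1) * sin z ^ r * cos z)) /
          (sin z ^ (r + 1) * sin z ^ (r + 1))) (at z)"
      using nz by (auto intro!: derivative_eq_intros simp del: of_nat_add of_nat_Suc power_Suc)
    also have "(- sin z * sin z ^ (r + 1) - cos z * (of_nat (r + 1) * sin z ^ r * cos z)) /
          (sin z ^ (r + 1) * sin z ^ (r + 1)) =
        - (1 / sin z ^ r) - of_nat (r + 1) * (cos z)\<^sup>2 / sin z ^ (r + 2)"
      using nz by (simp add: divide_simps power2_eq_square del: of_nat_add of_nat_Suc)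
        (simp add: algebra_simps del: of_nat_add of_nat_Suc)
    also have "\<dots> = of_nat r / sin z ^ r - of_nat (r + 1) / sin z ^ (r + 2)"
      using nz unfolding cos_squared_eq by (simp add: field_simps power2_eq_square)
    finally show "((\<lambda>z. cos z / sin z ^ (r + 1)) has_field_derivative
      of_nat r / sin z ^ r - of_nat (r + 1) / sin z ^ (r + 2)) (at z)" .
    show "((\<lambda>z. \<Sum>i\<le>q. c i * P (s + 2 * i) z) has_field_derivative
       (\<Sum>i\<le>q. c i * (- of_nat (s + 2 * i) * P (Suc (s + 2 * i)) z))) (at z)"
      using nz s by (intro DERIV_sum DERIV_cmult D) auto
  qed
  have d2: "of_nat (r + 1) * of_nat (r + 2) * (cos z / sin z ^ (r + 3)) - of_nat r ^ 2 * (cos z / sin z ^ (r + 1))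
      = (\<Sum>i\<le>q. c i * (of_nat ((s + 2 * i) * (s + 2 * i + 1)) * P (s + 2 * i + 2) z))"
    if z: "z \<in> X" for z
  proof (rule DERIV_unique_on_open[OF X z d1])
    have nz: "sin z \<noteq> 0" using z by (simp add: X_def)
    have "((\<lambda>z. of_nat r / sin z ^ r - of_nat (r + 1) / sin z ^ (r + 2)) has_field_derivative
       (- (of_nat r * (of_nat r * (cos z * sin z ^ (r - 1)))) / (sin z ^ r * sin z ^ r)
        - (- (of_nat (r + 1) * (of_nat (r + 2) * (cos z * sin z ^ (r + 1))))) /
            (sin z ^ (r + 2) * sin z ^ (r + 2)))) (at z)"
      using nz by (auto intro!: derivative_eq_intros simp del: of_nat_add of_nat_Suc power_Suc)
    moreover obtain r' where "r = Suc r'" using r(2) by (cases r) auto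
    moreover have "a * (a * (k * x ^ r')) / (x ^ Suc r' * x ^ Suc r') = a ^ 2 * (k / x ^ (Suc r' + 1))"
      "a * (b * (k * x ^ (r + 1))) / (x ^ (r + 2) * x ^ (r + 2)) = a * b * (k / x ^ (r + 3))"
      if "x \<noteq> 0" for a b x k :: complex
      using that by (simp_all add: divide_simps power2_eq_square power3_eq_cube power_add)
    ultimately show "((\<lambda>z. of_nat r / sin z ^ r - of_nat (r + 1) / sin z ^ (r + 2)) has_field_derivative
      of_nat (r + 1) * of_nat (r + 2) * (cos z / sin z ^ (r + 3)) - of_nat r ^ 2 * (cos z / sin z ^ (r + 1))) (at z)"
      using nz by (simp del: of_nat_add of_nat_Suc power_Suc)
    show "((\<lambda>z. \<Sum>i\<le>q. c i * (- of_nat (s + 2 * i) * P (Suc (s + 2 * i)) z)) has_field_derivative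
       (\<Sum>i\<le>q. c i * (of_nat ((s + 2 * i) * (s + 2 * i + 1)) * P (s + 2 * i + 2) z))) (at z)"
    proof (intro DERIV_sum DERIV_cmult)
      fix i
      have "((\<lambda>z. - of_nat (s + 2 * i) * P (Suc (s + 2 * i)) z) has_field_derivative
          - of_nat (s + 2 * i) * (- of_nat (Suc (s + 2 * i)) * P (Suc (Suc (s + 2 * i))) z)) (at z)"
        using nz by (intro DERIV_cmult D) auto
      then show "((\<lambda>z. - of_nat (s + 2 * i) * P (Suc (s + 2 * i)) z) has_field_derivative
          of_nat ((s + 2 * i) * (s + 2 * i + 1)) * P (s + 2 * i + 2) z) (at z)"
        by (simp add: algebra_simps)
    qed
  qed
  define K :: complex where "K = of_nat (r + 1) * of_nat (r + 2)"
  have K: "K \<noteq> 0" unfolding K_def by (simp del: of_nat_add of_nat_Suc of_nat_mult)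
  \<comment> \<open>\<open>d2\<close> is solved for cos / sin^(r+3): differentiating twice moves
    \<open>c (i - 1)\<close> from order s + 2(i - 1) to s + 2i, the lower term returns r^2 times the
    old expansion, and \<open>K\<close> is divided out.\<close>
  define c' where "c' = (\<lambda>i. (if i = 0 then 0 else c (i - 1) * of_nat ((s + 2 * (i - 1)) * (s + 2 * (i - 1) + 1)))
      + of_nat r ^ 2 * (if i \<le> q then c i else 0))"
  have "cos z / sin z ^ (s + 2 * Suc q) = (\<Sum>i\<le>Suc q. c' i / K * P (s + 2 * i) z)"
    if z: "z \<in> X" for z
  proof -
    have "(\<Sum>i\<le>Suc q. c' i * P (s + 2 * i) z) =
        (\<Sum>i\<le>Suc q. (if i = 0 then 0 else c (i - 1) * of_nat ((s + 2 * (i - 1)) * (s + 2 * (i - 1) + 1))) * P (s + 2 * i) z)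
        + of_nat r ^ 2 * (\<Sum>i\<le>Suc q. (if i \<le> q then c i else 0) * P (s + 2 * i) z)"
      by (simp only: c'_def distrib_right sum.distrib sum_distrib_left mult.assoc)
    also have "(\<Sum>i\<le>Suc q. (if i \<le> q then c i else 0) * P (s + 2 * i) z) = cos z / sin z ^ (r + 1)"
      unfolding c[OF z] by (rule sum.mono_neutral_cong_right) auto
    also have "(\<Sum>i\<le>Suc q. (if i = 0 then 0 else c (i - 1) * of_nat ((s + 2 * (i - 1)) * (s + 2 * (i - 1) + 1))) * P (s + 2 * i) z)
        = (\<Sum>i\<le>q. c i * (of_nat ((s + 2 * i) * (s + 2 * i + 1)) * P (s + 2 * i + 2) z))"
      by (subst sum.atMost_Suc_shift) (simp add: mult.assoc del: of_nat_add of_nat_Suc of_nat_mult)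
    also have "\<dots> = K * (cos z / sin z ^ (r + 3)) - of_nat r ^ 2 * (cos z / sin z ^ (r + 1))"
      unfolding K_def by (rule d2[OF z, symmetric])
    finally have "(\<Sum>i\<le>Suc q. c' i * P (s + 2 * i) z) = K * (cos z / sin z ^ (r + 3))" by simp
    moreover have "(\<Sum>i\<le>Suc q. c' i / K * P (s + 2 * i) z) = (\<Sum>i\<le>Suc q. c' i * P (s + 2 * i) z) / K"
      by (simp only: sum_divide_distrib times_divide_eq_left)
    moreover have "s + 2 * Suc q = r + 3" using r(1) by simp
    ultimately show ?thesis using K by (metis nonzero_mult_div_cancel_left)
  qed
  then show ?case unfolding pole_span_def X_def by (intro exI[of _ "\<lambda>i. c' i / K"]) blast
qed

section \<open>Chebyshev polynomials: recurrence and parity\<close>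

lemma cheb_U_eqI:
  assumes "\<And>\<theta>. sin \<theta> \<noteq> 0 \<Longrightarrow> poly p (cos \<theta>) = sin (of_nat (m + 1) * \<theta>) / sin \<theta>"
  shows "cheb_U m = p"
  using assms by (intro cheb_U_unique) (simp add: poly_cheb_U_cos)

lemma cheb_U_0: "cheb_U 0 = 1"
  by (rule cheb_U_eqI) simp

lemma cheb_U_1: "cheb_U 1 = [:0, 2:]"
  using sin_double[where 'a = complex] by (intro cheb_U_eqI) simp

lemma cheb_U_Suc_Suc: "cheb_U (Suc (Suc m)) = [:0, 2:] * cheb_U (Suc m) - cheb_U m"
proof (rule cheb_U_eqI)
  fix \<theta> :: complex assume nz: "sin \<theta> \<noteq> 0"
  define t where "t = of_nat (m + 2) * \<theta>"
  have "poly (cheb_U (Suc m)) (cos \<theta>) = sin t / sin \<theta>"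
    using poly_cheb_U_cos[OF nz, of "Suc m"] by (simp add: t_def)
  moreover have "poly (cheb_U m) (cos \<theta>) = sin (t - \<theta>) / sin \<theta>"
    using poly_cheb_U_cos[OF nz, of m] by (simp add: t_def algebra_simps)
  moreover have "sin (of_nat (Suc (Suc m) + 1) * \<theta>) = sin (t + \<theta>)"
    by (simp add: t_def algebra_simps)
  ultimately show "poly ([:0, 2:] * cheb_U (Suc m) - cheb_U m) (cos \<theta>) =
      sin (of_nat (Suc (Suc m) + 1) * \<theta>) / sin \<theta>"
    using nz by (simp add: sin_add sin_diff divide_simps) (simp add: algebra_simps)
qed

text \<open>Induction along the three-term recurrence. This parity is what makes the exponents of 1
  / sin z differ by multiples of two, so that a single family of pole sums suffices.\<close>

lemma cheb_U_parity:
  "\<exists>a. \<forall>y. poly (cheb_U m) y = (\<Sum>i\<le>m div 2. a i * y ^ (m - 2 * i))"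
proof (induction m rule: less_induct)
  case (less m)
  consider "m = 0" | "m = 1" | k where "m = Suc (Suc k)"
    by (metis One_nat_def not0_implies_Suc)
  then show ?case
  proof cases
    case 1
    then show ?thesis by (intro exI[of _ "\<lambda>_. 1"]) (simp add: cheb_U_0)
  next
    case 2
    then show ?thesis by (intro exI[of _ "\<lambda>_. 2"]) (simp add: cheb_U_1[simplified])
  next
    case (3 k)
    obtain a where a: "\<And>y. poly (cheb_U (Suc k)) y = (\<Sum>i\<le>Suc k div 2. a i * y ^ (Suc k - 2 * i))"
      using less.IH[of "Suc k"] 3 by auto
    obtain b where b: "\<And>y. poly (cheb_U k) y = (\<Sum>i\<le>k div 2. b i * y ^ (k - 2 * i))"
      using less.IH[of k] 3 by auto
    \<comment> \<open>Multiplying by 2y raises the degree by one and keeps the index i; U_k has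
      degree m - 2, so its coefficients move up one index. The first guard matters for even m, where
      the constant term of U_m receives nothing from 2y U_(k+1).\<close>
    define c where "c = (\<lambda>i. (if i \<le> Suc k div 2 then 2 * a i else 0) - (if i = 0 then 0 else b (i - 1)))"
    have "poly (cheb_U m) y = (\<Sum>i\<le>m div 2. c i * y ^ (m - 2 * i))" for y
    proof -
      have "(\<Sum>i\<le>m div 2. c i * y ^ (m - 2 * i)) =
          (\<Sum>i\<le>m div 2. (if i \<le> Suc k div 2 then 2 * a i else 0) * y ^ (m - 2 * i)) -
          (\<Sum>i\<le>Suc (k div 2). (if i = 0 then 0 else b (i - 1)) * y ^ (m - 2 * i))"
        by (simp add: c_def 3 left_diff_distrib sum_subtractf)
      also have "(\<Sum>i\<le>m div 2. (if i \<le> Suc k div 2 then 2 * a i else 0) * y ^ (m - 2 * i)) =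
          (\<Sum>i\<le>Suc k div 2. 2 * y * (a i * y ^ (Suc k - 2 * i)))"
      proof (rule sum.mono_neutral_cong_right)
        show "(if i \<le> Suc k div 2 then 2 * a i else 0) * y ^ (m - 2 * i) =
            2 * y * (a i * y ^ (Suc k - 2 * i))" if "i \<in> {..Suc k div 2}" for i
        proof -
          have "m - 2 * i = Suc (Suc k - 2 * i)" using that 3 by auto
          then show ?thesis using that by simp
        qed
      qed (auto simp: 3)
      also have "\<dots> = 2 * y * poly (cheb_U (Suc k)) y"
        by (simp only: a sum_distrib_left)
      also have "(\<Sum>i\<le>Suc (k div 2). (if i = 0 then 0 else b (i - 1)) * y ^ (m - 2 * i)) = poly (cheb_U k) y"
        by (subst sum.atMost_Suc_shift) (simp add: b 3)
      finally show ?thesis by (simp add: 3 cheb_U_Suc_Suc)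
    qed
    then show ?thesis by blast
  qed
qed

text \<open>The index s + 2q - 2 allows for the factor 1 / sin^2: the monomial of degree s + 2q - 2
  - 2i contributes cos / sin^(s + 2(q - i)), whose order lies between s and s + 2q.\<close>

lemma pole_span_cheb_U:
  assumes D: "\<And>m z. m \<ge> 1 \<Longrightarrow> sin z \<noteq> 0 \<Longrightarrow>
      (P m has_field_derivative - of_nat m * P (Suc m) z) (at z)"
    and base: "\<And>z. sin z \<noteq> 0 \<Longrightarrow> P s z = cos z / sin z ^ s"
    and s: "s = 2 \<or> s = 3"
  shows "pole_span P s q (\<lambda>z. poly (cheb_U (s + 2 * q - 2)) (1 / sin z) * cos z / sin z ^ 2)"
proof -
  define m where "m = s + 2 * q - 2"
  have m2: "m div 2 = q" using s by (auto simp: m_def)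
  obtain a where a: "\<And>y. poly (cheb_U m) y = (\<Sum>i\<le>q. a i * y ^ (m - 2 * i))"
    using cheb_U_parity[of m] m2 by auto
  have "pole_span P s q (\<lambda>z. \<Sum>i\<in>{..q}. a i * (cos z / sin z ^ (s + 2 * (q - i))))"
    using s by (intro pole_span_sum pole_span_mono[OF pole_span_cos_over_sin_power] D base) auto
  also have "(\<lambda>z. \<Sum>i\<in>{..q}. a i * (cos z / sin z ^ (s + 2 * (q - i)))) =
      (\<lambda>z. poly (cheb_U m) (1 / sin z) * cos z / sin z ^ 2)"
  proof
    fix z :: complex
    have "a i * (cos z / sin z ^ (s + 2 * (q - i))) =
        a i * (1 / sin z) ^ (m - 2 * i) * cos z / sin z ^ 2" if "i \<le> q" for i
    proof -
      have "s + 2 * (q - i) = (m - 2 * i) + 2" using that s by (auto simp: m_def)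
      then show ?thesis by (simp only: power_add) (simp add: power_divide)
    qed
    then show "(\<Sum>i\<in>{..q}. a i * (cos z / sin z ^ (s + 2 * (q - i)))) =
        poly (cheb_U m) (1 / sin z) * cos z / sin z ^ 2"
      by (simp add: a sum_distrib_right sum_divide_distrib)
  qed
  finally show ?thesis by (simp only: m_def)
qed

subsection \<open>Laurent coefficients as residues\<close>

lemma Arcsin_analytic_at_0: "Arcsin analytic_on {0}"
  unfolding analytic_at using holomorphic_on_Arcsin[of "ball 0 1"]
  by (intro exI[of _ "ball 0 1"]) (use abs_Re_le_cmod le_less_trans in fastforce)

text \<open>That the zero at 0 is simple makes the residue of Arcsin' / Arcsin there equal to
  1.\<close>

lemma Arcsin_laurent:
  obtains S where "Arcsin has_laurent_expansion S" "fls_subdegree S = 1" "S \<noteq> 0"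
proof -
  note an = Arcsin_analytic_at_0
  define F where "F = fps_expansion Arcsin 0"
  have F: "Arcsin has_fps_expansion F"
    unfolding F_def by (rule analytic_at_imp_has_fps_expansion_0[OF an])
  have "fps_nth F 0 = 0"
    using has_fps_expansion_imp_0_eq_fps_nth_0[OF F] by simp
  moreover have "fps_nth F 1 = 1"
    using DERIV_imp_deriv[OF has_field_derivative_Arcsin[of 0]] by (simp add: F_def fps_expansion_def)
  ultimately have sd: "subdegree F = 1" by (intro subdegreeI) auto
  then have "F \<noteq> 0" by auto
  with F sd show thesis
    by (intro that[of "fps_to_fls F"]) (auto simp: has_fps_expansion_to_laurent fls_subdegree_fls_to_fps)
qed

text \<open>Invariance of the residue under the substitution \<open>x = sin \<theta>\<close>.\<close>

lemma residue_Arcsin_power: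
  fixes e :: int
  shows "\<exists>E. (\<lambda>x. Arcsin x powi e * inverse (cos (Arcsin x))) has_laurent_expansion E \<and>
           fls_residue E = (if e = -1 then 1 else 0)"
proof -
  obtain S where S: "Arcsin has_laurent_expansion S" "fls_subdegree S = 1" "S \<noteq> 0"
    using Arcsin_laurent by blast
  have re: "Im x = 0 \<Longrightarrow> \<bar>Re x\<bar> < 1" if "x \<in> ball 0 1" for x
    using that abs_Re_le_cmod[of x] by auto
  have nz: "Arcsin x \<noteq> 0" if "x \<noteq> 0" for x using that by (metis sin_Arcsin sin_zero)
  have S': "(\<lambda>x. inverse (cos (Arcsin x))) has_laurent_expansion fls_deriv S"
    by (rule has_laurent_expansion_deriv'[OF S(1) open_ball[of 0 1]])
      (use re in \<open>auto intro!: has_field_derivative_Arcsin\<close>)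
  show ?thesis
  \<comment> \<open>The factor 1 / cos (Arcsin x) is Arcsin'. For e = -1 the function is a
    logarithmic derivative, with residue the order of the zero; for any other e it is the derivative
    of Arcsin^(e+1) / (e+1), and a derivative has residue 0.\<close>
  proof (cases "e = -1")
    case True
    have "(\<lambda>x. inverse (Arcsin x) * inverse (cos (Arcsin x))) has_laurent_expansion inverse S * fls_deriv S"
      by (intro laurent_expansion_intros S S')
    moreover have "fls_residue (inverse S * fls_deriv S) = 1"
      using fls_residue_deriv_times_inverse_eq_subdegree(2)[of S] S(2) by simp
    ultimately show ?thesis using True by (auto simp: power_int_minus)
  next
    case False
    define c where "c = (of_int (e + 1) :: complex)"
    have c: "c \<noteq> 0" using False unfolding c_def by (metis add_eq_0_iff2 minus_minus of_int_eq_0_iff)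
    have "(\<lambda>x. 1 / c * Arcsin x powi (e + 1)) has_laurent_expansion fls_const (1 / c) * S powi (e + 1)"
      by (intro laurent_expansion_intros S)
    then have "(\<lambda>x. Arcsin x powi e * inverse (cos (Arcsin x)))
        has_laurent_expansion fls_deriv (fls_const (1 / c) * S powi (e + 1))"
    proof (rule has_laurent_expansion_deriv'[OF _ open_ball[of 0 1]])
      fix x :: complex assume x: "x \<in> ball 0 1 - {0}"
      have "((\<lambda>x. Arcsin x powi (e + 1)) has_field_derivative
          of_int (e + 1) * Arcsin x powi (e + 1 - 1) * inverse (cos (Arcsin x))) (at x)"
        by (rule derivative_eq_intros DERIV_power_int has_field_derivative_Arcsin refl | use x re[of x] nz[of x] in simp)+
      from DERIV_cmult[OF this, of "1 / c"] c
      show "((\<lambda>x. 1 / c * Arcsin x powi (e + 1)) has_field_derivative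
          Arcsin x powi e * inverse (cos (Arcsin x))) (at x)"
        by (simp add: c_def[symmetric] del: of_int_add)
    qed auto
    then show ?thesis using False fls_residue_deriv by fastforce
  qed
qed

lemma has_laurent_expansion_sum_residue:
  assumes "finite I" "\<And>i. i \<in> I \<Longrightarrow> \<exists>E. f i has_laurent_expansion E \<and> fls_residue E = r i"
  shows "\<exists>E. (\<lambda>x. \<Sum>i\<in>I. f i x) has_laurent_expansion E \<and> fls_residue E = (\<Sum>i\<in>I. r i)"
proof -
  obtain E where E: "\<And>i. i \<in> I \<Longrightarrow> f i has_laurent_expansion E i \<and> fls_residue (E i) = r i"
    using assms(2) by metis
  have "fls_residue (\<Sum>i\<in>I. E i) = (\<Sum>i\<in>I. r i)"
    using assms(1) E by (induction I rule: finite_induct) auto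
  moreover have "(\<lambda>x. \<Sum>i\<in>I. f i x) has_laurent_expansion (\<Sum>i\<in>I. E i)"
    using E by (intro laurent_expansion_intros) auto
  ultimately show ?thesis by blast
qed

text \<open>The coefficient of x is the residue after division by x^2. Replacing U(1/x) / x^2 by the
  pole expansion over cos z, z = Arcsin x, gives terms z^j / z^(s+2k) times dz/dx; with j = s + 2i -
  1 the exponent is -1 exactly for k = i, and the analytic remainders have residue 0.\<close>

lemma laurent_coeff_x_pole_expansion:
  fixes U :: "complex poly" and c :: "nat \<Rightarrow> complex"
  assumes F: "\<And>z. sin z \<noteq> 0 \<Longrightarrow>
      poly U (1 / sin z) * cos z / sin z ^ 2 = (\<Sum>k\<le>q. c k * P (s + 2 * k) z)"
    and near: "\<And>m. m \<ge> 1 \<Longrightarrow> \<exists>g. g analytic_on {0} \<and> (\<forall>z. sin z \<noteq> 0 \<longrightarrow> P m z = 1 / z ^ m + g z)"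
    and i: "i \<le> q" and s: "s \<ge> 1"
  shows "laurent_coeff_x (\<lambda>x. poly U (1 / x) * Arcsin x ^ (s + 2 * i - 1)) = c i"
proof -
  define j where "j = s + 2 * i - 1"
  obtain S where S: "Arcsin has_laurent_expansion S" "fls_subdegree S = 1" "S \<noteq> 0"
    using Arcsin_laurent by blast
  have "(\<lambda>x. \<Sum>k\<le>degree U. coeff U k * (1 / x) ^ k) has_laurent_expansion
      (\<Sum>k\<le>degree U. fls_const (coeff U k) * (1 / fls_X) ^ k)"
    by (intro laurent_expansion_intros)
  then obtain L where L: "(\<lambda>x. poly U (1 / x) * Arcsin x ^ j) has_laurent_expansion L"
    using has_laurent_expansion_mult[OF _ has_laurent_expansion_power[OF S(1)]]
    unfolding poly_altdef by blast
  have R: "(\<lambda>x. poly U (1 / x) * Arcsin x ^ j * x powi - 2) has_laurent_expansion fls_shift 2 L"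
    by (rule has_laurent_expansion_shift'[OF L])
  have "\<forall>k. \<exists>g. g analytic_on {0} \<and> (\<forall>z. sin z \<noteq> 0 \<longrightarrow> P (s + 2 * k) z = 1 / z ^ (s + 2 * k) + g z)"
    using near s by simp
  then obtain g where g: "\<And>k. g k analytic_on {0}"
    "\<And>k z. sin z \<noteq> 0 \<Longrightarrow> P (s + 2 * k) z = 1 / z ^ (s + 2 * k) + g k z" by metis
  note an = Arcsin_analytic_at_0
  have res: "\<exists>E. (\<lambda>x. c k * (Arcsin x powi (int j - int (s + 2 * k)) * inverse (cos (Arcsin x)))
        + c k * (Arcsin x ^ j * g k (Arcsin x) * inverse (cos (Arcsin x)))) has_laurent_expansion E \<and>
      fls_residue E = (if k = i then c i else 0)" for k
  proof -
    have gA: "(\<lambda>x. g k (Arcsin x)) analytic_on {0}"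
      using analytic_on_compose_gen[OF an g(1)[of k]] by (simp add: o_def)
    have "(\<lambda>x. Arcsin x ^ j * g k (Arcsin x) * inverse (cos (Arcsin x))) analytic_on {0}"
      by (intro analytic_intros an gA) auto
    then obtain H where "(\<lambda>x. Arcsin x ^ j * g k (Arcsin x) * inverse (cos (Arcsin x))) has_fps_expansion H"
      using analytic_at_imp_has_fps_expansion_0 by blast
    then have H: "(\<lambda>x. Arcsin x ^ j * g k (Arcsin x) * inverse (cos (Arcsin x))) has_laurent_expansion fps_to_fls H"
      by (rule has_laurent_expansion_fps)
    obtain E where E: "(\<lambda>x. Arcsin x powi (int j - int (s + 2 * k)) * inverse (cos (Arcsin x))) has_laurent_expansion E"
      "fls_residue E = (if int j - int (s + 2 * k) = -1 then 1 else 0)"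
      using residue_Arcsin_power by blast
    have "int j - int (s + 2 * k) = -1 \<longleftrightarrow> k = i" using s by (auto simp: j_def)
    with E(2) have "fls_residue (fls_const (c k) * E + fls_const (c k) * fps_to_fls H) = (if k = i then c i else 0)"
      by simp
    then show ?thesis using E(1) H
      by (intro exI[of _ "fls_const (c k) * E + fls_const (c k) * fps_to_fls H"])
        (auto intro!: laurent_expansion_intros)
  qed
  have "\<exists>E. (\<lambda>x. \<Sum>k\<le>q. c k * (Arcsin x powi (int j - int (s + 2 * k)) * inverse (cos (Arcsin x)))
        + c k * (Arcsin x ^ j * g k (Arcsin x) * inverse (cos (Arcsin x)))) has_laurent_expansion E \<and>
      fls_residue E = (\<Sum>k\<le>q. if k = i then c i else 0)"
    by (rule has_laurent_expansion_sum_residue[OF _ res]) simp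
  then obtain E where E: "(\<lambda>x. \<Sum>k\<le>q. c k * (Arcsin x powi (int j - int (s + 2 * k)) * inverse (cos (Arcsin x)))
        + c k * (Arcsin x ^ j * g k (Arcsin x) * inverse (cos (Arcsin x)))) has_laurent_expansion E"
      "fls_residue E = (\<Sum>k\<le>q. if k = i then c i else 0)"
    by blast
  have ev: "eventually (\<lambda>x. poly U (1 / x) * Arcsin x ^ j * x powi - 2 =
      (\<Sum>k\<le>q. c k * (Arcsin x powi (int j - int (s + 2 * k)) * inverse (cos (Arcsin x)))
        + c k * (Arcsin x ^ j * g k (Arcsin x) * inverse (cos (Arcsin x))))) (at 0)"
  proof -
    have "eventually (\<lambda>x::complex. x \<in> ball 0 1 - {0}) (at 0)"
      by (intro eventually_at_in_open) auto
    then show ?thesis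
    proof eventually_elim
      case (elim x)
      define z where "z = Arcsin x"
      have sz: "sin z = x" "x \<noteq> 0" using elim by (auto simp: z_def)
      have z: "z \<noteq> 0" using sz by auto
      \<comment> \<open>The factor cos z in \<open>F\<close> has to be divided out; it vanishes only
        for x = 1 or x = -1, outside the unit disc.\<close>
      have cz: "cos z \<noteq> 0"
      proof
        assume "cos z = 0"
        then have "x ^ 2 = 1" using sin_squared_eq[of z] sz by simp
        then have "x = 1 \<or> x = -1" by (simp add: power2_eq_1_iff)
        then show False using elim by auto
      qed
      have "poly U (1 / x) / x ^ 2 = inverse (cos z) * (\<Sum>k\<le>q. c k * (1 / z ^ (s + 2 * k) + g k z))"
        using F[of z] g(2)[of z] sz cz by (simp add: field_simps)
      then have "poly U (1 / x) * z ^ j * x powi - 2 =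
          (\<Sum>k\<le>q. z ^ j * (inverse (cos z) * (c k * (1 / z ^ (s + 2 * k) + g k z))))"
        by (simp only: sum_distrib_left[symmetric]) (simp add: power_int_minus divide_inverse mult_ac)
      also have "\<dots> = (\<Sum>k\<le>q. c k * (z powi (int j - int (s + 2 * k)) * inverse (cos z)) +
          c k * (z ^ j * g k z * inverse (cos z)))"
        using z by (intro sum.cong refl) (simp add: power_int_diff algebra_simps divide_inverse flip: power_int_of_nat)
      finally show ?case by (simp add: z_def)
    qed
  qed
  have "(\<lambda>x. poly U (1 / x) * Arcsin x ^ j * x powi - 2) has_laurent_expansion E"
    by (rule iffD2[OF has_laurent_expansion_cong[OF ev refl] E(1)])
  with R have "fls_shift 2 L = E" by (rule has_laurent_expansion_unique)
  with E(2) have "fls_nth L 1 = c i" using i by auto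
  then show ?thesis
    unfolding laurent_coeff_x_def j_def[symmetric] laurent_expansion_0_eqI[OF L] .
qed

subsection \<open>Integrals of a single pair of poles\<close>

text \<open>Up to the factor i^m, the joint contribution at pi/2 + iu of two poles at distance b on
  either side of pi/2. It is odd in u, so division by u creates no singularity at 0.\<close>

definition pole_diff :: "nat \<Rightarrow> real \<Rightarrow> real \<Rightarrow> complex" where
  "pole_diff m b u = 1 / (of_real u - \<i> * of_real b) ^ m - 1 / (- of_real u - \<i> * of_real b) ^ m"

lemma pole_diff_nonzero:
  assumes "b > 0"
  shows "of_real u - \<i> * of_real b \<noteq> 0" "- of_real u - \<i> * of_real b \<noteq> 0"
  using assms by (auto simp: complex_eq_iff)

text \<open>Factoring a difference of m-th powers isolates 1/z - 1/w = -2u / (zw), which cancels the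
  u in the denominator and leaves 1 / (u^2 + b^2). The cofactor has m terms, each at most 1 /
  b^(m-1) in modulus.\<close>

lemma norm_pole_diff_le:
  assumes "b > 0" "u > 0" "m \<ge> 1"
  shows "norm (pole_diff m b u / of_real u) \<le> 2 * real m / b ^ (m - 1) * (1 / (u\<^sup>2 + b\<^sup>2))"
proof -
  define z w where "z = of_real u - \<i> * of_real b" and "w = - of_real u - \<i> * of_real b"
  have nz: "z \<noteq> 0" "w \<noteq> 0" using pole_diff_nonzero[OF assms(1)] by (auto simp: z_def w_def)
  define \<rho> where "\<rho> = sqrt (u\<^sup>2 + b\<^sup>2)"
  have n: "norm z = \<rho>" "norm w = \<rho>" by (simp_all add: z_def w_def \<rho>_def cmod_def)
  have \<rho>: "\<rho> \<ge> b" "\<rho> > 0" "\<rho>\<^sup>2 = u\<^sup>2 + b\<^sup>2"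
    using assms by (auto simp: \<rho>_def real_le_rsqrt add_pos_pos)
  obtain k where m: "m = Suc k" using assms(3) by (cases m) auto
  define T where "T = (\<Sum>p<Suc k. (1 / z) ^ p * (1 / w) ^ (k - p))"
  have "pole_diff m b u = (1 / z - 1 / w) * T"
    unfolding T_def diff_power_eq_sum[symmetric] by (simp add: pole_diff_def z_def w_def m power_divide)
  moreover have "1 / z - 1 / w = - 2 * of_real u / (z * w)"
  proof -
    have "1 / z - 1 / w = (w - z) / (z * w)" using nz by (simp add: divide_simps)
    then show ?thesis by (simp add: z_def w_def)
  qed
  ultimately have "norm (pole_diff m b u) = 2 * u / \<rho>\<^sup>2 * norm T"
    using assms by (simp add: norm_mult norm_divide n power2_eq_square)
  moreover have "norm T \<le> real m / b ^ k"
  proof -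
    have "norm (\<Sum>p<Suc k. (1 / z) ^ p * (1 / w) ^ (k - p)) \<le> (\<Sum>p<Suc k. 1 / b ^ k)"
    proof (rule sum_norm_le)
      fix p assume "p \<in> {..<Suc k}"
      then have "norm ((1 / z) ^ p * (1 / w) ^ (k - p)) = 1 / \<rho> ^ k"
        by (simp add: norm_mult norm_power norm_divide n power_divide flip: power_add)
      also have "\<dots> \<le> 1 / b ^ k"
        using assms \<rho> by (intro divide_left_mono power_mono mult_pos_pos zero_less_power) auto
      finally show "norm ((1 / z) ^ p * (1 / w) ^ (k - p)) \<le> 1 / b ^ k" .
    qed
    then show ?thesis by (simp add: m T_def)
  qed
  ultimately have "norm (pole_diff m b u) \<le> 2 * u / \<rho>\<^sup>2 * (real m / b ^ k)"
    using assms by (metis mult_left_mono divide_nonneg_nonneg less_imp_le mult_nonneg_nonneg zero_le_numeral zero_le_power2)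
  moreover have "norm (pole_diff m b u / of_real u) = norm (pole_diff m b u) / u"
    using assms by (simp add: norm_divide)
  ultimately have "norm (pole_diff m b u / of_real u) \<le> 2 * u / \<rho>\<^sup>2 * (real m / b ^ k) / u"
    using assms by (metis divide_right_mono less_imp_le)
  also have "\<dots> = 2 * real m / b ^ (m - 1) * (1 / (u\<^sup>2 + b\<^sup>2))"
    using assms by (simp add: m \<rho>(3))
  finally show ?thesis .
qed

lemma has_real_derivative_arctan_scaled:
  assumes "b > 0"
  shows "((\<lambda>u. arctan (u / b) / b) has_real_derivative 1 / (u\<^sup>2 + b\<^sup>2)) (at u)"
  using assms by (auto intro!: derivative_eq_intros simp: field_simps power2_eq_square)
    (simp_all add: add_nonneg_eq_0_iff flip: power2_eq_square)

lemma inverse_quadratic_integral: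
  assumes "b > 0"
  shows "set_integrable lborel {0<..} (\<lambda>u::real. 1 / (u\<^sup>2 + b\<^sup>2))"
    and "(LBINT u:{0<..}. 1 / (u\<^sup>2 + b\<^sup>2)) = pi / (2 * b)"
proof -
  have e: "einterval (ereal 0) \<infinity> = {0<..}" by (auto simp: einterval_def)
  note d = has_real_derivative_arctan_scaled[OF assms]
  have c: "isCont (\<lambda>u::real. 1 / (u\<^sup>2 + b\<^sup>2)) u" for u
    using assms by (intro continuous_intros) (auto simp: add_nonneg_eq_0_iff)
  have l0: "(((\<lambda>u. arctan (u / b) / b) \<circ> real_of_ereal) \<longlongrightarrow> 0) (at_right (ereal 0))"
  proof -
    have "isCont (\<lambda>u. arctan (u / b) / b) 0" using assms by (intro continuous_intros) auto
    then have "((\<lambda>u. arctan (u / b) / b) \<longlongrightarrow> 0) (at_right 0)"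
      using assms by (simp add: isCont_def filterlim_at_split)
    then show ?thesis by (simp add: ereal_tendsto_simps1)
  qed
  have l1: "(((\<lambda>u. arctan (u / b) / b) \<circ> real_of_ereal) \<longlongrightarrow> pi / (2 * b)) (at_left \<infinity>)"
  proof -
    have "filterlim (\<lambda>u. u / b) at_top at_top"
      using assms by real_asymp
    then have "((\<lambda>u. arctan (u / b)) \<longlongrightarrow> pi / 2) at_top"
      by (rule filterlim_compose[OF tendsto_arctan_at_top])
    then have "((\<lambda>u. arctan (u / b) / b) \<longlongrightarrow> pi / 2 / b) at_top"
      using assms by (intro tendsto_divide tendsto_const) auto
    then show ?thesis by (simp add: ereal_tendsto_simps1)
  qed
  note F = interval_integral_FTC_nonneg[of "ereal 0" \<infinity> "\<lambda>u. arctan (u / b) / b", OF _ d c _ l0 l1]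
  show "set_integrable lborel {0<..} (\<lambda>u::real. 1 / (u\<^sup>2 + b\<^sup>2))"
    using F(1) by (simp add: e)
  show "(LBINT u:{0<..}. 1 / (u\<^sup>2 + b\<^sup>2)) = pi / (2 * b)"
    using F(2) by (simp add: e interval_lebesgue_integral_def)
qed

lemma set_integrable_pole_diff:
  assumes "b > 0" "m \<ge> 1"
  shows "set_integrable lborel {0<..} (\<lambda>u. pole_diff m b u / of_real u)"
proof (rule set_integrable_bound)
  show "set_integrable lborel {0<..} (\<lambda>u. 2 * real m / b ^ (m - 1) * (1 / (u\<^sup>2 + b\<^sup>2)))"
    by (intro set_integrable_mult_right inverse_quadratic_integral assms)
  show "set_borel_measurable lborel {0<..} (\<lambda>u. pole_diff m b u / of_real u)"
    unfolding set_borel_measurable_def pole_diff_def by measurable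
  show "AE u in lborel. u \<in> {0<..} \<longrightarrow> norm (pole_diff m b u / of_real u) \<le>
      norm (2 * real m / b ^ (m - 1) * (1 / (u\<^sup>2 + b\<^sup>2)))"
    using norm_pole_diff_le[OF assms(1) _ assms(2)] assms(1)
    by (intro always_eventually allI impI) (auto intro: order.trans)
qed

lemma has_field_derivative_inverse_power:
  fixes f :: "complex \<Rightarrow> complex"
  assumes "(f has_field_derivative D) (at x)" "f x \<noteq> 0"
  shows "((\<lambda>x. 1 / f x ^ m) has_field_derivative - of_nat m * D / f x ^ Suc m) (at x)"
proof (cases m)
  case (Suc k)
  have "((\<lambda>x. inverse (f x)) has_field_derivative - (inverse (f x) * D * inverse (f x))) (at x)"
    using assms by (rule DERIV_inverse')
  from DERIV_power[OF this, of m] assms(2) show ?thesis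
    by (simp add: Suc divide_inverse power_inverse mult_ac del: of_nat_Suc)
qed simp

text \<open>Partial fractions reduce the order: with \<open>z = u - ib\<close> and \<open>w = -u - ib\<close> one has
  \<open>(1/z\<^sup>m\<^sup>+\<^sup>1 - 1/w\<^sup>m\<^sup>+\<^sup>1) / u = (i/b) ((1/z\<^sup>m - 1/w\<^sup>m) / u - (1/z\<^sup>m\<^sup>+\<^sup>1 + 1/w\<^sup>m\<^sup>+\<^sup>1))\<close>, and the
  last bracket is the derivative of \<open>- (1/z\<^sup>m - 1/w\<^sup>m) / m\<close>, which vanishes at both ends.\<close>

lemma pole_diff_antiderivative:
  assumes b: "b > 0" and m: "m \<ge> 1"
  shows "\<exists>A. (\<forall>u>0. (A has_vector_derivative pole_diff m b u / of_real u) (at u)) \<and>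
           (A \<longlongrightarrow> 0) (at_right 0) \<and> (A \<longlongrightarrow> of_real pi * \<i> ^ (m - 1) / of_real b ^ m) at_top"
  using m
proof (induction m rule: dec_induct)
  case base
  define A where "A = (\<lambda>u. complex_of_real (2 * (arctan (u / b) / b)))"
  show ?case
  proof (intro exI[of _ A] conjI allI impI)
    fix u :: real assume "u > 0"
    have "((\<lambda>u. 2 * (arctan (u / b) / b)) has_real_derivative 2 * (1 / (u\<^sup>2 + b\<^sup>2))) (at u)"
      by (intro DERIV_cmult has_real_derivative_arctan_scaled b)
    then have "(A has_vector_derivative of_real (2 * (1 / (u\<^sup>2 + b\<^sup>2)))) (at u)"
      unfolding A_def by (rule has_vector_derivative_of_real)
    also have "of_real (2 * (1 / (u\<^sup>2 + b\<^sup>2))) = pole_diff 1 b u / of_real u"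
    proof -
      have nz: "complex_of_real u - \<i> * of_real b \<noteq> 0" "- complex_of_real u - \<i> * of_real b \<noteq> 0"
        by (rule pole_diff_nonzero[OF b])+
      have "pole_diff 1 b u / of_real u = - 2 / ((of_real u - \<i> * of_real b) * (- of_real u - \<i> * of_real b))"
        unfolding pole_diff_def using nz \<open>u > 0\<close> by (simp add: divide_simps)
      also have "(of_real u - \<i> * of_real b) * (- of_real u - \<i> * of_real b) = - complex_of_real (u\<^sup>2 + b\<^sup>2)"
        by (simp add: algebra_simps power2_eq_square)
      finally have "pole_diff 1 b u / of_real u = 2 / complex_of_real (u\<^sup>2 + b\<^sup>2)"
        by (simp only: minus_divide_divide)
      then show ?thesis by simp
    qed
    finally show "(A has_vector_derivative pole_diff 1 b u / of_real u) (at u)" .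
  next
    have "isCont A 0" unfolding A_def using b by (intro continuous_intros) auto
    then show "(A \<longlongrightarrow> 0) (at_right 0)" by (simp add: isCont_def filterlim_at_split A_def)
  next
    have "filterlim (\<lambda>u. u / b) at_top at_top"
      using b by real_asymp
    then have "((\<lambda>u. arctan (u / b)) \<longlongrightarrow> pi / 2) at_top"
      by (rule filterlim_compose[OF tendsto_arctan_at_top])
    then have "(A \<longlongrightarrow> of_real (2 * (pi / 2 / b))) at_top"
      unfolding A_def using b by (intro tendsto_intros) auto
    then show "(A \<longlongrightarrow> of_real pi * \<i> ^ (1 - 1) / of_real b ^ 1) at_top" by simp
  qed
next
  case (step m)
  then obtain A where A: "\<And>u. u > 0 \<Longrightarrow> (A has_vector_derivative pole_diff m b u / of_real u) (at u)"
    "(A \<longlongrightarrow> 0) (at_right 0)" "(A \<longlongrightarrow> of_real pi * \<i> ^ (m - 1) / of_real b ^ m) at_top" by blast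
  define k where "k = m - 1"
  have m: "m = Suc k" using step by (simp add: k_def)
  define c where "c = \<i> / of_real b"
  define B where "B = (\<lambda>u. c * A u + c / of_nat m * pole_diff m b u)"
  show ?case
  proof (intro exI[of _ B] conjI allI impI)
    fix u :: real assume u: "u > 0"
    define z w where "z = of_real u - \<i> * of_real b" and "w = - of_real u - \<i> * of_real b"
    have nz: "z \<noteq> 0" "w \<noteq> 0" using pole_diff_nonzero[OF b] by (auto simp: z_def w_def)
    have "((\<lambda>v. 1 / (v - \<i> * of_real b) ^ m - 1 / (- v - \<i> * of_real b) ^ m) has_field_derivative
        - of_nat m * 1 / z ^ Suc m - - of_nat m * (- 1) / w ^ Suc m) (at (of_real u))"
      unfolding z_def w_def
      by (intro DERIV_diff has_field_derivative_inverse_power) (use nz in \<open>auto intro!: derivative_eq_intros simp: z_def w_def\<close>)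
    also have "- of_nat m * 1 / z ^ Suc m - - of_nat m * (- 1) / w ^ Suc m =
        of_nat m * (- 1 / z ^ Suc m - 1 / w ^ Suc m)"
      by (simp add: algebra_simps del: power_Suc)
    finally have "((\<lambda>v. 1 / (v - \<i> * of_real b) ^ m - 1 / (- v - \<i> * of_real b) ^ m) has_field_derivative
        of_nat m * (- 1 / z ^ Suc m - 1 / w ^ Suc m)) (at (of_real u))" .
    from has_vector_derivative_real_field[OF this]
    have "(pole_diff m b has_vector_derivative of_nat m * (- 1 / z ^ Suc m - 1 / w ^ Suc m)) (at u)"
      by (simp add: pole_diff_def[abs_def])
    then have "(B has_vector_derivative c * (pole_diff m b u / of_real u) +
        c / of_nat m * (of_nat m * (- 1 / z ^ Suc m - 1 / w ^ Suc m))) (at u)"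
      unfolding B_def by (intro has_vector_derivative_add has_vector_derivative_mult_right A u)
    also have "c / of_nat m * (of_nat m * (- 1 / z ^ Suc m - 1 / w ^ Suc m)) = - c * (1 / z ^ Suc m + 1 / w ^ Suc m)"
      using step by (simp add: m field_simps del: of_nat_Suc)
    also have "c * (pole_diff m b u / of_real u) + - c * (1 / z ^ Suc m + 1 / w ^ Suc m) =
        pole_diff (Suc m) b u / of_real u"
    proof -
      have cb: "of_real b = \<i> / c" using b by (simp add: c_def)
      have c0: "c \<noteq> 0" using b by (simp add: c_def)
      have U: "complex_of_real u \<noteq> 0" using u by simp
      \<comment> \<open>Because -ib = 1/c, both c (z - u) and c (w + u) equal 1; inserting these
        factors is the partial fraction step from order m to m + 1.\<close>
      have z: "z = of_real u + 1 / c" and w: "w = - of_real u + 1 / c"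
        using c0 by (simp_all add: z_def w_def cb)
      have 1: "c * (1 / z ^ m / of_real u) - c * (1 / z ^ Suc m) = 1 / z ^ Suc m / of_real u"
      proof -
        have "c * (1 / z ^ m / of_real u) - c * (1 / z ^ Suc m) = c * (z - of_real u) * (1 / z ^ Suc m / of_real u)"
          using nz U by (simp add: field_simps)
        also have "c * (z - of_real u) = 1" using c0 by (simp add: z)
        finally show ?thesis by simp
      qed
      have 2: "c * (1 / w ^ m / of_real u) + c * (1 / w ^ Suc m) = 1 / w ^ Suc m / of_real u"
      proof -
        have "c * (1 / w ^ m / of_real u) + c * (1 / w ^ Suc m) = c * (w + of_real u) * (1 / w ^ Suc m / of_real u)"
          using nz U by (simp add: field_simps)
        also have "c * (w + of_real u) = 1" using c0 by (simp add: w)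
        finally show ?thesis by simp
      qed
      have "pole_diff (Suc m) b u / of_real u = 1 / z ^ Suc m / of_real u - 1 / w ^ Suc m / of_real u"
        by (simp only: pole_diff_def z_def w_def diff_divide_distrib)
      also have "\<dots> = c * ((1 / z ^ m - 1 / w ^ m) / of_real u) + - c * (1 / z ^ Suc m + 1 / w ^ Suc m)"
        unfolding 1[symmetric] 2[symmetric] by (simp add: diff_divide_distrib algebra_simps)
      finally show ?thesis by (simp only: pole_diff_def z_def w_def)
    qed
    finally show "(B has_vector_derivative pole_diff (Suc m) b u / of_real u) (at u)" .
  next
    have "isCont (pole_diff m b) 0" unfolding pole_diff_def[abs_def]
      using pole_diff_nonzero[OF b] b by (intro continuous_intros) auto
    then have "(pole_diff m b \<longlongrightarrow> 0) (at_right 0)"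
      by (simp add: isCont_def filterlim_at_split pole_diff_def)
    then have "(B \<longlongrightarrow> c * 0 + c / of_nat m * 0) (at_right 0)"
      unfolding B_def by (intro tendsto_intros A)
    then show "(B \<longlongrightarrow> 0) (at_right 0)" by simp
  next
    have l: "((\<lambda>u. 1 / (s * of_real u - \<i> * of_real b)) \<longlongrightarrow> 0) at_top" if "norm s = 1" for s
    proof -
      have "filterlim (\<lambda>u. complex_of_real u) at_infinity at_top"
        by (rule filterlim_of_real_at_infinity)
      moreover have "s \<noteq> 0" using that by auto
      ultimately have "filterlim (\<lambda>u. s * complex_of_real u) at_infinity at_top"
        by (intro tendsto_mult_filterlim_at_infinity[of "\<lambda>_. s" s]) auto
      then have "filterlim (\<lambda>u. - (\<i> * of_real b) + s * complex_of_real u) at_infinity at_top"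
        by (intro tendsto_add_filterlim_at_infinity[OF tendsto_const])
      then have "((\<lambda>u. inverse (- (\<i> * of_real b) + s * complex_of_real u)) \<longlongrightarrow> 0) at_top"
        by (rule filterlim_compose[OF tendsto_inverse_0])
      then show ?thesis by (simp add: inverse_eq_divide)
    qed
    have "((\<lambda>u. (1 / (1 * of_real u - \<i> * of_real b)) ^ m - (1 / ((-1) * of_real u - \<i> * of_real b)) ^ m)
        \<longlongrightarrow> 0 ^ m - 0 ^ m) at_top"
      by (intro tendsto_diff tendsto_power l) auto
    then have "(pole_diff m b \<longlongrightarrow> 0) at_top"
      by (simp add: pole_diff_def[abs_def] power_divide)
    then have "(B \<longlongrightarrow> c * (of_real pi * \<i> ^ (m - 1) / of_real b ^ m) + c / of_nat m * 0) at_top"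
      unfolding B_def by (intro tendsto_intros A)
    then show "(B \<longlongrightarrow> of_real pi * \<i> ^ (Suc m - 1) / of_real b ^ Suc m) at_top"
      by (simp add: c_def m mult_ac)
  qed
qed

lemma integral_pole_diff:
  assumes "b > 0" "m \<ge> 1"
  shows "(LBINT u:{0<..}. pole_diff m b u / of_real u) = of_real pi * \<i> ^ (m - 1) / of_real b ^ m"
proof -
  have e: "einterval (ereal 0) \<infinity> = {0<..}" by (auto simp: einterval_def)
  obtain A where A: "\<And>u. u > 0 \<Longrightarrow> (A has_vector_derivative pole_diff m b u / of_real u) (at u)"
    "(A \<longlongrightarrow> 0) (at_right 0)" "(A \<longlongrightarrow> of_real pi * \<i> ^ (m - 1) / of_real b ^ m) at_top"
    using pole_diff_antiderivative[OF assms] by blast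
  have "(LBINT u=ereal 0..\<infinity>. pole_diff m b u / of_real u) = of_real pi * \<i> ^ (m - 1) / of_real b ^ m - 0"
  proof (rule interval_integral_FTC_integrable)
    show "isCont (\<lambda>u. pole_diff m b u / of_real u) x" if "ereal 0 < ereal x" for x
      using pole_diff_nonzero[OF assms(1)] that unfolding pole_diff_def[abs_def]
      by (intro continuous_intros) auto
    show "set_integrable lborel (einterval (ereal 0) \<infinity>) (\<lambda>u. pole_diff m b u / of_real u)"
      unfolding e by (rule set_integrable_pole_diff[OF assms])
    show "((A \<circ> real_of_ereal) \<longlongrightarrow> 0) (at_right (ereal 0))"
      using A(2) by (simp add: ereal_tendsto_simps1)
    show "((A \<circ> real_of_ereal) \<longlongrightarrow> of_real pi * \<i> ^ (m - 1) / of_real b ^ m) (at_left \<infinity>)"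
      using A(3) by (simp add: ereal_tendsto_simps1)
  qed (use A(1) in auto)
  then show ?thesis by (simp add: interval_lebesgue_integral_def e)
qed

section \<open>Summing over all pole pairs\<close>

lemma summable_half_integer_powers:
  assumes "k \<ge> 2"
  shows "summable (\<lambda>r. 1 / (pi * (real r + 1 / 2)) ^ k)"
proof (rule summable_comparison_test')
  show "summable (\<lambda>r. inverse (real (Suc r) ^ k))"
    using assms by (subst summable_Suc_iff) (rule inverse_power_summable)
  fix r :: nat
  have "real (Suc r) \<le> 2 * (real r + 1 / 2)" by simp
  also have "\<dots> \<le> pi * (real r + 1 / 2)" using pi_ge_two by (intro mult_right_mono) auto
  finally have "real (Suc r) ^ k \<le> (pi * (real r + 1 / 2)) ^ k" by (intro power_mono) auto
  moreover have "pi * (real r + 1 / 2) > 0" by (simp add: add_nonneg_pos)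
  ultimately show "norm (1 / (pi * (real r + 1 / 2)) ^ k) \<le> inverse (real (Suc r) ^ k)"
    by (simp add: inverse_eq_divide frac_le del: of_nat_Suc)
qed

text \<open>Dropping u^2 from the bound leaves terms of size b^-(m+1). This pointwise absolute
  convergence serves both the exchange of sum and integral and the ungrouping of the alternating
  series.\<close>

lemma summable_pole_diff:
  assumes "m \<ge> 2" "u > 0"
  shows "summable (\<lambda>r. norm (pole_diff m (pi * (real r + 1 / 2)) u / of_real u))"
proof (rule summable_comparison_test')
  show "summable (\<lambda>r. 2 * real m * (1 / (pi * (real r + 1 / 2)) ^ (m + 1)))"
    using assms by (intro summable_mult summable_half_integer_powers) auto
  fix r :: nat
  define b where "b = pi * (real r + 1 / 2)"
  have b: "b > 0" by (simp add: b_def add_nonneg_pos)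
  have "norm (pole_diff m b u / of_real u) \<le> 2 * real m / b ^ (m - 1) * (1 / (u\<^sup>2 + b\<^sup>2))"
    using assms by (intro norm_pole_diff_le b) auto
  also have "\<dots> \<le> 2 * real m / b ^ (m - 1) * (1 / b\<^sup>2)"
    using b by (intro mult_left_mono divide_left_mono mult_pos_pos add_nonneg_pos) auto
  also have "\<dots> = 2 * real m * (1 / b ^ (m + 1))"
  proof -
    have "b ^ (m + 1) = b ^ (m - 1) * b\<^sup>2" using assms by (simp flip: power_add)
    then show ?thesis by simp
  qed
  finally show "norm (norm (pole_diff m (pi * (real r + 1 / 2)) u / of_real u)) \<le>
      2 * real m * (1 / (pi * (real r + 1 / 2)) ^ (m + 1))"
    by (simp add: b_def)
qed

text \<open>Sum and integral may be exchanged since the r-th term has L1 norm at most m pi / b^m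
  with b = pi (r + 1/2), which is summable for m at least 2. A general unimodular
  \<open>\<epsilon>\<close> covers the plain and the alternating series at once.\<close>

lemma sums_integral_pole_diff:
  fixes \<epsilon> :: complex
  assumes m: "m \<ge> 2" and \<epsilon>: "norm \<epsilon> = 1"
    and Q: "\<And>u. u > 0 \<Longrightarrow> (\<lambda>r. \<epsilon> ^ r * pole_diff m (pi * (real r + 1 / 2)) u) sums Q u"
  shows "(\<lambda>u. Q u / of_real u) absolutely_integrable_on {0<..}"
    and "integral {0<..} (\<lambda>u. Q u / of_real u) =
      \<i> ^ (m - 1) * (of_real pi * (\<Sum>r. \<epsilon> ^ r / of_real (pi * (real r + 1 / 2)) ^ m))"
proof -
  define b where "b = (\<lambda>r. pi * (real r + 1 / 2))"
  have b: "b r > 0" for r by (simp add: b_def add_nonneg_pos)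
  define f where "f = (\<lambda>r u. indicator {0<..} u *\<^sub>R (\<epsilon> ^ r * (pole_diff m (b r) u / of_real u)))"
  have int1: "set_integrable lborel {0<..} (\<lambda>u. \<epsilon> ^ r * (pole_diff m (b r) u / of_real u))" for r
    using m b by (intro set_integrable_mult_right set_integrable_pole_diff) auto
  have int: "integrable lborel (f r)" for r
    using int1[of r] by (simp add: set_integrable_def f_def)
  have bound: "norm (f r u) \<le> 2 * real m / b r ^ (m - 1) * (indicator {0<..} u *\<^sub>R (1 / (u\<^sup>2 + (b r)\<^sup>2)))" for r u
  proof (cases "u > 0")
    case True
    have "norm (f r u) = norm (pole_diff m (b r) u / of_real u)"
      using True \<epsilon> by (simp add: f_def norm_mult norm_power norm_divide)
    then show ?thesis using norm_pole_diff_le[OF b True, of m r] m True by simp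
  qed (simp add: f_def)
  have summ: "summable (\<lambda>r. 1 / b r ^ k)" if "k \<ge> 2" for k
    unfolding b_def by (rule summable_half_integer_powers[OF that])
  have "summable (\<lambda>r. norm (f r u))" for u
    using summable_pole_diff[OF m, of u] \<epsilon>
    by (cases "u > 0") (simp_all add: f_def b_def norm_mult norm_power norm_divide)
  then have A: "AE u in lborel. summable (\<lambda>r. norm (f r u))" by simp
  have B: "summable (\<lambda>r. LINT u|lborel. norm (f r u))"
  proof (rule summable_comparison_test')
    show "summable (\<lambda>r. real m * pi * (1 / b r ^ m))"
      using m by (intro summable_mult summ) auto
    fix r :: nat
    have "(LINT u|lborel. norm (f r u)) \<le>
        (LINT u|lborel. 2 * real m / b r ^ (m - 1) * (indicator {0<..} u *\<^sub>R (1 / (u\<^sup>2 + (b r)\<^sup>2))))"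
      using inverse_quadratic_integral(1)[OF b[of r]]
      by (intro integral_mono integrable_norm int integrable_mult_right bound)
        (simp add: set_integrable_def)
    also have "\<dots> = 2 * real m / b r ^ (m - 1) * (pi / (2 * b r))"
      using inverse_quadratic_integral(2)[OF b[of r]] unfolding set_lebesgue_integral_def
      by (simp only: integral_mult_right_zero)
    also have "\<dots> = real m * pi * (1 / b r ^ m)"
      using m b[of r] by (cases m) (auto simp: field_simps)
    finally show "norm (LINT u|lborel. norm (f r u)) \<le> real m * pi * (1 / b r ^ m)" by simp
  qed
  have sumf: "(\<Sum>r. f r u) = indicator {0<..} u *\<^sub>R (Q u / of_real u)" for u
  proof (cases "u > 0")
    case True
    have "(\<lambda>r. \<epsilon> ^ r * pole_diff m (b r) u / of_real u) sums (Q u / of_real u)"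
      using Q[OF True] by (intro sums_divide) (simp add: b_def)
    then show ?thesis using True by (simp add: f_def sums_iff)
  qed (simp add: f_def)
  have si: "set_integrable lborel {0<..} (\<lambda>u. Q u / of_real u)"
    using integrable_suminf[OF int A B] by (simp add: sumf set_integrable_def)
  then show "(\<lambda>u. Q u / of_real u) absolutely_integrable_on {0<..}"
    unfolding set_integrable_def by (rule integrable_completion[THEN iffD2, rotated]) (use si in \<open>auto simp: set_integrable_def\<close>)
  have "integral {0<..} (\<lambda>u. Q u / of_real u) = (LBINT u:{0<..}. Q u / of_real u)"
    using set_borel_integral_eq_integral(2)[OF si] by simp
  also have "\<dots> = (\<Sum>r. LINT u|lborel. f r u)"
    using integral_suminf[OF int A B] by (simp add: sumf set_lebesgue_integral_def)
  also have "(\<lambda>r. LINT u|lborel. f r u) =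
      (\<lambda>r. \<i> ^ (m - 1) * (of_real pi * (\<epsilon> ^ r / of_real (pi * (real r + 1 / 2)) ^ m)))"
  proof
    fix r
    have "(LINT u|lborel. f r u) = (LBINT u:{0<..}. \<epsilon> ^ r * (pole_diff m (b r) u / of_real u))"
      by (simp only: f_def set_lebesgue_integral_def)
    also have "\<dots> = \<epsilon> ^ r * (LBINT u:{0<..}. pole_diff m (b r) u / of_real u)"
      by (rule set_integral_mult_right)
    also have "\<dots> = \<i> ^ (m - 1) * (of_real pi * (\<epsilon> ^ r / of_real (b r) ^ m))"
      using m by (subst integral_pole_diff[OF b]) auto
    finally show "(LINT u|lborel. f r u) =
      \<i> ^ (m - 1) * (of_real pi * (\<epsilon> ^ r / of_real (pi * (real r + 1 / 2)) ^ m))"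
      by (simp only: b_def)
  qed
  also have "(\<Sum>r. \<i> ^ (m - 1) * (of_real pi * (\<epsilon> ^ r / of_real (pi * (real r + 1 / 2)) ^ m))) =
      \<i> ^ (m - 1) * (of_real pi * (\<Sum>r. \<epsilon> ^ r / of_real (pi * (real r + 1 / 2)) ^ m))"
  proof -
    have "summable (\<lambda>r. norm (\<epsilon> ^ r / complex_of_real (b r) ^ m))"
      using summ[OF m] b \<epsilon> by (simp add: norm_divide norm_power less_imp_le)
    then have "summable (\<lambda>r. \<epsilon> ^ r / complex_of_real (pi * (real r + 1 / 2)) ^ m)"
      unfolding b_def by (rule summable_norm_cancel)
    then show ?thesis by (simp only: suminf_mult summable_mult)
  qed
  finally show "integral {0<..} (\<lambda>u. Q u / of_real u) =
      \<i> ^ (m - 1) * (of_real pi * (\<Sum>r. \<epsilon> ^ r / of_real (pi * (real r + 1 / 2)) ^ m))" .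
qed

subsection \<open>Substitution and summation\<close>

text \<open>Obtained by differentiating \<open>per_pole_2\<close>; it is the starting point for the
  odd orders.\<close>

lemma per_pole_3:
  assumes "sin z \<noteq> 0"
  shows "per_pole 3 z = cos z / sin z ^ 3"
proof -
  have X: "open {z::complex. sin z \<noteq> 0}" by (intro open_Collect_neq continuous_intros)
  have 1: "(per_pole 2 has_field_derivative - of_nat 2 * per_pole (Suc 2) z) (at z)"
    by (rule has_field_derivative_per_pole) (use assms in auto)
  have 2: "((\<lambda>z. 1 / sin z ^ 2) has_field_derivative - of_nat 2 * cos z / sin z ^ Suc 2) (at z)"
    by (rule has_field_derivative_inverse_power[OF DERIV_sin assms])
  have "- of_nat 2 * per_pole (Suc 2) z = - of_nat 2 * cos z / sin z ^ Suc 2"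
    by (rule DERIV_unique_on_open[OF X _ per_pole_2 1 2]) (use assms in auto)
  then have "per_pole (Suc 2) z = cos z / sin z ^ Suc 2"
    by (simp del: power_Suc flip: times_divide_eq_right)
  moreover have "Suc 2 = 3" by simp
  ultimately show ?thesis by (simp only:)
qed

text \<open>As pi/2 is the midpoint of -k pi and (k+1) pi, the two differences are iu + b and iu - b
  with b = pi (k + 1/2). Extracting i, respectively -i, produces the denominators of
  \<open>pole_diff\<close>; the factor i^m absorbs the i, and (-1)^m remains in the second.\<close>

lemma inverse_powers_at_half_pi:
  fixes u :: real
  defines "z \<equiv> of_real pi / 2 + \<i> * of_real u"
  defines "b \<equiv> \<lambda>k::nat. complex_of_real (pi * (real k + 1 / 2))"
  shows "\<i> ^ m * (1 / (z + of_nat k * of_real pi) ^ m) = 1 / (of_real u - \<i> * b k) ^ m"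
    and "\<i> ^ m * (1 / (z - of_nat (Suc k) * of_real pi) ^ m) = (-1) ^ m / (- of_real u - \<i> * b k) ^ m"
proof -
  have "z + of_nat k * of_real pi = \<i> * (of_real u - \<i> * b k)"
    by (simp add: z_def b_def algebra_simps)
  then show "\<i> ^ m * (1 / (z + of_nat k * of_real pi) ^ m) = 1 / (of_real u - \<i> * b k) ^ m"
    by (simp only: power_mult_distrib) simp
  have "z - of_nat (Suc k) * of_real pi = - (\<i> * (- of_real u - \<i> * b k))"
    by (simp add: z_def b_def algebra_simps)
  then have "(z - of_nat (Suc k) * of_real pi) ^ m = (-1) ^ m * (\<i> ^ m * (- of_real u - \<i> * b k) ^ m)"
    by (metis power_minus power_mult_distrib)
  then show "\<i> ^ m * (1 / (z - of_nat (Suc k) * of_real pi) ^ m) = (-1) ^ m / (- of_real u - \<i> * b k) ^ m"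
    by (cases "even m") simp_all
qed

lemma sin_half_pi_plus_i: "sin (of_real pi / 2 + \<i> * of_real u) = complex_of_real (cosh u)"
  and cos_half_pi_plus_i: "cos (of_real pi / 2 + \<i> * of_real u) = - \<i> * complex_of_real (sinh u)"
proof -
  have "complex_of_real (cosh u) = cosh (of_real u)" "complex_of_real (sinh u) = sinh (of_real u)"
    by (simp_all add: cosh_field_def sinh_field_def exp_of_real flip: of_real_minus)
  then show "sin (of_real pi / 2 + \<i> * of_real u) = complex_of_real (cosh u)"
    "cos (of_real pi / 2 + \<i> * of_real u) = - \<i> * complex_of_real (sinh u)"
    by (simp_all add: sin_add cos_add cosh_conv_cos sinh_conv_sin)
qed

text \<open>For odd m the remaining sign (-1)^m turns the sum over a pole pair into
  \<open>pole_diff\<close>. The factor 1^r matches the shape used for general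
  \<open>\<epsilon>\<close>.\<close>

lemma per_pole_at_half_pi:
  assumes "odd m" "m \<ge> 2"
  shows "(\<lambda>r. 1 ^ r * pole_diff m (pi * (real r + 1 / 2)) u) sums
           (\<i> ^ m * per_pole m (of_real pi / 2 + \<i> * of_real u))"
proof -
  define z where "z = of_real pi / 2 + \<i> * complex_of_real u"
  have "sin z \<noteq> 0" by (simp add: z_def sin_half_pi_plus_i)
  from sums_mult[OF per_pole_sums[OF this assms(2)], of "\<i> ^ m"]
  show ?thesis using assms(1)
    by (simp only: distrib_left z_def inverse_powers_at_half_pi pole_diff_def) simp
qed

text \<open>For even m the minus sign comes from the weights: k and k+1 have opposite parity, so the
  poles -k pi and (k+1) pi are weighted oppositely. The defining series only delivers the terms in
  consecutive pairs.\<close>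

lemma alt_pole_at_half_pi:
  assumes "even m" "m \<ge> 2" "u > 0"
  shows "(\<lambda>r. (-1) ^ r * pole_diff m (pi * (real r + 1 / 2)) u) sums
           (\<i> ^ m * alt_pole m (of_real pi / 2 + \<i> * of_real u))"
proof -
  define z where "z = of_real pi / 2 + \<i> * complex_of_real u"
  define f where "f = (\<lambda>r. (-1) ^ r * pole_diff m (pi * (real r + 1 / 2)) u)"
  have nz: "sin z \<noteq> 0" by (simp add: z_def sin_half_pi_plus_i)
  have scale: "1 / (a / 2) ^ m / 2 ^ m = 1 / a ^ m" for a :: complex
    by (simp add: power_divide)
  have e: "(-1) ^ m = (1 :: complex)" using assms(1) by simp
  have alg: "p * ((a1 + a2 - (a3 + a4)) / d) = p * (a1 / d) + p * (a2 / d) - (p * (a3 / d) + p * (a4 / d))"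
    for p a1 a2 a3 a4 d :: complex
    by (simp add: diff_divide_distrib add_divide_distrib algebra_simps)
  \<comment> \<open>The half-angle sums pair the poles differently from \<open>pole_diff\<close>: a1
    and a4 belong to index 2k, a3 and a2 to index 2k + 1.\<close>
  have lin: "a1 + a2 - (a3 + a4) = a1 - a4 - (a3 - a2)" for a1 a2 a3 a4 :: complex
    by simp
  have "(\<lambda>k. \<i> ^ m * (((1 / (z / 2 + of_nat k * of_real pi) ^ m + 1 / (z / 2 - of_nat (Suc k) * of_real pi) ^ m) -
         (1 / (z / 2 + of_real pi / 2 + of_nat k * of_real pi) ^ m
           + 1 / (z / 2 + of_real pi / 2 - of_nat (Suc k) * of_real pi) ^ m)) / 2 ^ m))
      sums (\<i> ^ m * alt_pole m z)"
    unfolding alt_pole_def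
    by (intro sums_mult sums_divide sums_diff per_pole_sums sin_nonzero_half nz assms)
  also have "(\<lambda>k. \<i> ^ m * (((1 / (z / 2 + of_nat k * of_real pi) ^ m + 1 / (z / 2 - of_nat (Suc k) * of_real pi) ^ m) -
         (1 / (z / 2 + of_real pi / 2 + of_nat k * of_real pi) ^ m
           + 1 / (z / 2 + of_real pi / 2 - of_nat (Suc k) * of_real pi) ^ m)) / 2 ^ m)) =
      (\<lambda>k. sum f {k * 2..<k * 2 + 2})"
  proof
    fix k :: nat
    have h': "z / 2 + of_nat k * of_real pi = (z + of_nat (2 * k) * of_real pi) / 2"
      "z / 2 - of_nat (Suc k) * of_real pi = (z - of_nat (Suc (Suc (2 * k))) * of_real pi) / 2"
      "z / 2 + of_real pi / 2 + of_nat k * of_real pi = (z + of_nat (Suc (2 * k)) * of_real pi) / 2"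
      "z / 2 + of_real pi / 2 - of_nat (Suc k) * of_real pi = (z - of_nat (Suc (2 * k)) * of_real pi) / 2"
      by (simp_all add: field_simps)
    have h: "1 / (z / 2 + of_nat k * of_real pi) ^ m / 2 ^ m = 1 / (z + of_nat (2 * k) * of_real pi) ^ m"
      "1 / (z / 2 - of_nat (Suc k) * of_real pi) ^ m / 2 ^ m = 1 / (z - of_nat (Suc (Suc (2 * k))) * of_real pi) ^ m"
      "1 / (z / 2 + of_real pi / 2 + of_nat k * of_real pi) ^ m / 2 ^ m = 1 / (z + of_nat (Suc (2 * k)) * of_real pi) ^ m"
      "1 / (z / 2 + of_real pi / 2 - of_nat (Suc k) * of_real pi) ^ m / 2 ^ m = 1 / (z - of_nat (Suc (2 * k)) * of_real pi) ^ m"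
      by (simp_all only: h' scale)
    have "{k * 2..<k * 2 + 2} = {2 * k, Suc (2 * k)}" by auto
    then have "sum f {k * 2..<k * 2 + 2} = pole_diff m (pi * (real (2 * k) + 1 / 2)) u
        - pole_diff m (pi * (real (Suc (2 * k)) + 1 / 2)) u"
      by (simp add: f_def del: of_nat_Suc of_nat_mult)
    then show "\<i> ^ m * (((1 / (z / 2 + of_nat k * of_real pi) ^ m + 1 / (z / 2 - of_nat (Suc k) * of_real pi) ^ m) -
         (1 / (z / 2 + of_real pi / 2 + of_nat k * of_real pi) ^ m
           + 1 / (z / 2 + of_real pi / 2 - of_nat (Suc k) * of_real pi) ^ m)) / 2 ^ m) =
         sum f {k * 2..<k * 2 + 2}"
      unfolding alg h by (simp only: z_def inverse_powers_at_half_pi pole_diff_def e) (rule lin)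
  qed
  finally have g: "(\<lambda>k. sum f {k * 2..<k * 2 + 2}) sums (\<i> ^ m * alt_pole m z)" .
  \<comment> \<open>A convergent grouped series does not determine the ungrouped one; absolute
    summability of \<open>f\<close> closes this gap.\<close>
  have "summable (\<lambda>r. norm (pole_diff m (pi * (real r + 1 / 2)) u))"
    using summable_mult2[OF summable_pole_diff[OF assms(2,3)], of u] assms(3)
    by (simp add: norm_divide)
  moreover have "norm (f r) = norm (pole_diff m (pi * (real r + 1 / 2)) u)" for r
    by (simp only: f_def norm_mult norm_power norm_minus_cancel norm_one power_one mult_1)
  ultimately have "summable f"
    by - (rule summable_norm_cancel, simp only:)
  then have f: "f sums suminf f" by (rule summable_sums)
  have "suminf f = \<i> ^ m * alt_pole m z"
    by (rule sums_unique2[OF sums_group[OF f] g]) simp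
  with f have "f sums (\<i> ^ m * alt_pole m z)" by (simp only:)
  then show ?thesis by (simp only: f_def z_def)
qed

section \<open>Change of variables u = - ln (tan x)\<close>

lemma cosh_sinh_ln_tan:
  fixes x :: real
  assumes "0 < x" "x < pi / 2"
  shows "cosh (- ln (tan x)) = 1 / sin (2 * x)" "sinh (- ln (tan x)) = cos (2 * x) / sin (2 * x)"
proof -
  have t: "tan x > 0" using assms by (rule tan_gt_zero)
  have sc: "sin x > 0" "cos x > 0" using assms by (auto intro!: sin_gt_zero cos_gt_zero)
  have "cosh (- ln (tan x)) = (tan x + inverse (tan x)) / 2"
    using t by (simp add: cosh_ln_real)
  also have "\<dots> = ((sin x)\<^sup>2 + (cos x)\<^sup>2) / (2 * sin x * cos x)"
    using sc by (simp add: tan_def field_simps power2_eq_square)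
  finally show "cosh (- ln (tan x)) = 1 / sin (2 * x)" by (simp only: sin_cos_squared_add sin_double)
  have "sinh (- ln (tan x)) = (inverse (tan x) - tan x) / 2"
    using sinh_ln_real[OF t] by (simp add: diff_divide_distrib)
  also have "\<dots> = ((cos x)\<^sup>2 - (sin x)\<^sup>2) / (2 * sin x * cos x)"
    using sc by (simp add: tan_def field_simps power2_eq_square)
  finally show "sinh (- ln (tan x)) = cos (2 * x) / sin (2 * x)" by (simp only: cos_double sin_double)
qed

text \<open>The map g x = - ln (tan x) is a bijection from (0, pi/4) onto the positive reals with
  |g'| = 2 / sin 2x. This explains the factor sin (2x) / 2 in the hypothesis on \<open>F\<close>;
  its minus sign compensates u = - ln (tan x) in the denominator.\<close>

lemma has_integral_ln_tan_substitution:
  fixes H :: "real \<Rightarrow> complex" and F :: "real \<Rightarrow> complex"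
  assumes H: "(\<lambda>u. H u / of_real u) absolutely_integrable_on {0<..}"
    and F: "\<And>x. 0 < x \<Longrightarrow> x < pi / 4 \<Longrightarrow> H (- ln (tan x)) = - of_real (sin (2 * x) / 2) * F x"
  shows "((\<lambda>x. F x / of_real (ln (tan x))) has_integral integral {0<..} (\<lambda>u. H u / of_real u)) {0..pi / 4}"
proof -
  define g where "g = (\<lambda>x::real. - ln (tan x))"
  define g' where "g' = (\<lambda>x::real. - (2 / sin (2 * x)))"
  define S where "S = {0<..<pi / 4}"
  have pos: "tan x > 0" "sin x > 0" "cos x > 0" "sin (2 * x) > 0" if "x \<in> S" for x
    using that by (auto simp: S_def intro!: tan_gt_zero sin_gt_zero cos_gt_zero)
  have S: "S \<in> sets lebesgue" by (simp add: S_def)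
  have dg: "(g has_field_derivative g' x) (at x within S)" if "x \<in> S" for x
  proof -
    have "(g has_field_derivative - (inverse (tan x) * inverse ((cos x)\<^sup>2))) (at x)"
      unfolding g_def using pos[OF that]
      by (auto intro!: derivative_eq_intros simp: divide_inverse mult.commute)
    also have "- (inverse (tan x) * inverse ((cos x)\<^sup>2)) = g' x"
      unfolding g'_def tan_def sin_double using pos(2,3)[OF that] by (simp add: field_simps power2_eq_square)
    finally show ?thesis by (rule has_field_derivative_at_within)
  qed
  have inj: "inj_on g S"
  proof (rule inj_onI)
    fix x y assume xy: "x \<in> S" "y \<in> S" "g x = g y"
    then have "tan x = tan y" using pos by (simp add: g_def)
    then have "arctan (tan x) = arctan (tan y)" by simp
    then show "x = y" using xy by (simp add: S_def arctan_tan)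
  qed
  have img: "g ` S = {0<..}"
  proof (intro subset_antisym subsetI)
    fix u assume "u \<in> g ` S"
    then obtain x where x: "x \<in> S" "u = g x" by blast
    then have "tan x < tan (pi / 4)" by (intro tan_monotone) (auto simp: S_def)
    then show "u \<in> {0<..}" using x pos by (simp add: g_def tan_45)
  next
    fix u :: real assume "u \<in> {0<..}"
    then have u: "exp (- u) < 1" by simp
    have "arctan (exp (- u)) < arctan 1" using u by (simp only: arctan_less_iff)
    then have "arctan (exp (- u)) \<in> S" by (simp add: S_def arctan_one)
    moreover have "g (arctan (exp (- u))) = u" by (simp add: g_def tan_arctan)
    ultimately show "u \<in> g ` S" by (metis image_eqI)
  qed
  have "(\<lambda>x. \<bar>g' x\<bar> *\<^sub>R (H (g x) / of_real (g x))) absolutely_integrable_on S \<and>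
      integral S (\<lambda>x. \<bar>g' x\<bar> *\<^sub>R (H (g x) / of_real (g x))) = integral {0<..} (\<lambda>u. H u / of_real u)"
    using has_absolute_integral_change_of_variables_real[of S g g' "\<lambda>u. H u / of_real u", OF S dg inj] H
    unfolding img by blast
  then have "((\<lambda>x. \<bar>g' x\<bar> *\<^sub>R (H (g x) / of_real (g x))) has_integral
      integral {0<..} (\<lambda>u. H u / of_real u)) S"
    by (metis (no_types, lifting) set_lebesgue_integral_eq_integral(1) integrable_integral)
  also have "?this \<longleftrightarrow> ((\<lambda>x. F x / of_real (ln (tan x))) has_integral
      integral {0<..} (\<lambda>u. H u / of_real u)) S"
  proof (rule has_integral_cong)
    fix x assume x: "x \<in> S"
    have "\<bar>g' x\<bar> *\<^sub>R (H (g x) / of_real (g x)) =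
        of_real (2 / sin (2 * x)) * (- of_real (sin (2 * x) / 2) * F x / - of_real (ln (tan x)))"
      using x F[of x] pos[OF x] by (simp add: g_def g'_def S_def scaleR_conv_of_real)
    also have "\<dots> = F x / of_real (ln (tan x))"
      using pos[OF x] by simp
    finally show "\<bar>g' x\<bar> *\<^sub>R (H (g x) / of_real (g x)) = F x / of_real (ln (tan x))" .
  qed
  \<comment> \<open>The endpoints form a null set; there ln (tan x) is 0, by the convention for ln 0
    at x = 0, and the quotient takes the default value 0.\<close>
  finally show ?thesis by (simp only: S_def has_integral_Icc_iff_Ioo)
qed

text \<open>Common core of both formulas, to be used with \<open>per_pole\<close>, s = 3,
  \<open>\<epsilon>\<close> = 1 and with \<open>alt_pole\<close>, s = 2, \<open>\<epsilon>\<close> =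
  -1. In the prefactor - \<open>\<kappa>\<close> / 2 the sign comes from ln (tan x) = -u and the 1/2
  from dx = sin (2x) / 2 du up to orientation.\<close>

lemma sums_imp_has_integral_ln_tan:
  fixes P :: "nat \<Rightarrow> complex \<Rightarrow> complex" and \<epsilon> \<kappa> :: complex
  assumes D: "\<And>m z. m \<ge> 1 \<Longrightarrow> sin z \<noteq> 0 \<Longrightarrow>
      (P m has_field_derivative - of_nat m * P (Suc m) z) (at z)"
    and base: "\<And>z. sin z \<noteq> 0 \<Longrightarrow> P s z = cos z / sin z ^ s"
    and s: "s = 2 \<or> s = 3"
    and near: "\<And>m. m \<ge> 1 \<Longrightarrow> \<exists>g. g analytic_on {0} \<and> (\<forall>z. sin z \<noteq> 0 \<longrightarrow> P m z = 1 / z ^ m + g z)"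
    and \<epsilon>: "norm \<epsilon> = 1"
    and Q: "\<And>k u. u > 0 \<Longrightarrow> (\<lambda>r. \<epsilon> ^ r * pole_diff (s + 2 * k) (pi * (real r + 1 / 2)) u) sums
        (\<i> ^ (s + 2 * k) * P (s + 2 * k) (of_real pi / 2 + \<i> * of_real u))"
    and F: "\<And>x. 0 < x \<Longrightarrow> x < pi / 4 \<Longrightarrow> F x = \<kappa> * poly (cheb_U (s + 2 * q - 2)) (of_real (sin (2 * x))) * of_real (cos (2 * x))"
  shows "((\<lambda>x. F x / of_real (ln (tan x))) has_integral
      (- \<kappa> / 2 * (\<Sum>k\<le>q. laurent_coeff_x (\<lambda>x. poly (cheb_U (s + 2 * q - 2)) (1 / x) * Arcsin x ^ (s + 2 * k - 1)) *
         (of_real pi * (\<Sum>r. \<epsilon> ^ r / of_real (pi * (real r + 1 / 2)) ^ (s + 2 * k)))))) {0..pi / 4}"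
proof -
  define U where "U = cheb_U (s + 2 * q - 2)"
  obtain c where c: "\<And>z. sin z \<noteq> 0 \<Longrightarrow>
      poly U (1 / sin z) * cos z / sin z ^ 2 = (\<Sum>k\<le>q. c k * P (s + 2 * k) z)"
    using pole_span_cheb_U[of P s q, OF D base s] by (auto simp: pole_span_def U_def)
  have lc: "laurent_coeff_x (\<lambda>x. poly U (1 / x) * Arcsin x ^ (s + 2 * k - 1)) = c k" if "k \<le> q" for k
    using s by (intro laurent_coeff_x_pole_expansion[OF c near that]) auto
  define m where "m = (\<lambda>k. s + 2 * k)"
  have m: "m k \<ge> 2" for k using s by (auto simp: m_def)
  define z where "z = (\<lambda>u. of_real pi / 2 + \<i> * complex_of_real u)"
  have Q': "(\<lambda>r. \<epsilon> ^ r * pole_diff (m k) (pi * (real r + 1 / 2)) u) sums (\<i> ^ m k * P (m k) (z u))"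
    if "u > 0" for k u using Q[OF that] by (simp only: m_def z_def)
  define f where "f = (\<lambda>k u. \<i> ^ m k * P (m k) (z u) / of_real u)"
  have f: "f k absolutely_integrable_on {0<..}"
    "integral {0<..} (f k) = \<i> ^ (m k - 1) *
       (of_real pi * (\<Sum>r. \<epsilon> ^ r / of_real (pi * (real r + 1 / 2)) ^ m k))" for k
    unfolding f_def using sums_integral_pole_diff[OF m \<epsilon> Q'] by blast+
  \<comment> \<open>The factor i cancels the -i in cos (pi/2 + iu) = -i sinh u.\<close>
  define H where "H = (\<lambda>u. - \<kappa> / 2 * (\<i> * (poly U (1 / sin (z u)) * cos (z u) / sin (z u) ^ 2)))"
  have H: "H u / of_real u = - \<kappa> / 2 * (\<Sum>k\<le>q. c k / \<i> ^ (m k - 1) * f k u)" for u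
  proof -
    have nz: "sin (z u) \<noteq> 0" by (simp add: z_def sin_half_pi_plus_i)
    have "H u / of_real u = - \<kappa> / 2 * (\<i> * (\<Sum>k\<le>q. c k * P (m k) (z u)) / of_real u)"
      unfolding H_def m_def c[OF nz] by simp
    also have "\<i> * (\<Sum>k\<le>q. c k * P (m k) (z u)) / of_real u = (\<Sum>k\<le>q. \<i> * (c k * P (m k) (z u)) / of_real u)"
      by (simp only: sum_distrib_left sum_divide_distrib)
    also have "(\<Sum>k\<le>q. \<i> * (c k * P (m k) (z u)) / of_real u) = (\<Sum>k\<le>q. c k / \<i> ^ (m k - 1) * f k u)"
    proof (intro sum.cong refl)
      fix k
      \<comment> \<open>The power i^(m-1) split off here cancels against the one in the integral of
        \<open>f k\<close>.\<close>
      have "\<i> ^ m k = \<i> * \<i> ^ (m k - 1)" using m[of k] by (simp flip: power_Suc)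
      then show "\<i> * (c k * P (m k) (z u)) / of_real u = c k / \<i> ^ (m k - 1) * f k u"
        by (simp add: f_def)
    qed
    finally show ?thesis .
  qed
  have abs: "(\<lambda>u. H u / of_real u) absolutely_integrable_on {0<..}"
    unfolding H by (intro set_integrable_mult_right absolutely_integrable_sum f) auto
  have "integral {0<..} (\<lambda>u. H u / of_real u) = - \<kappa> / 2 * (\<Sum>k\<le>q. c k / \<i> ^ (m k - 1) * integral {0<..} (f k))"
    unfolding H using f(1)[THEN set_lebesgue_integral_eq_integral(1)]
    by (simp only: integral_mult_right) (subst integral_sum, auto intro: integrable_on_mult_right)
  also have "\<dots> = - \<kappa> / 2 * (\<Sum>k\<le>q. laurent_coeff_x (\<lambda>x. poly U (1 / x) * Arcsin x ^ (s + 2 * k - 1)) *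
         (of_real pi * (\<Sum>r. \<epsilon> ^ r / of_real (pi * (real r + 1 / 2)) ^ (s + 2 * k))))"
  proof -
    have "c k / \<i> ^ (m k - 1) * integral {0<..} (f k) =
        laurent_coeff_x (\<lambda>x. poly U (1 / x) * Arcsin x ^ (s + 2 * k - 1)) *
         (of_real pi * (\<Sum>r. \<epsilon> ^ r / of_real (pi * (real r + 1 / 2)) ^ (s + 2 * k)))" if "k \<le> q" for k
      unfolding f lc[OF that] by (simp add: m_def)
    then have "(\<Sum>k\<le>q. c k / \<i> ^ (m k - 1) * integral {0<..} (f k)) =
        (\<Sum>k\<le>q. laurent_coeff_x (\<lambda>x. poly U (1 / x) * Arcsin x ^ (s + 2 * k - 1)) *
         (of_real pi * (\<Sum>r. \<epsilon> ^ r / of_real (pi * (real r + 1 / 2)) ^ (s + 2 * k))))"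
      by (intro sum.cong refl) auto
    then show ?thesis by (rule arg_cong)
  qed
  finally have "integral {0<..} (\<lambda>u. H u / of_real u) = \<dots>" .
  moreover have "H (- ln (tan x)) = - of_real (sin (2 * x) / 2) * F x" if "0 < x" "x < pi / 4" for x
  proof -
    have ii: "\<i> * (a * (\<i> * b)) = - (a * b)" for a b
      using i_squared by (simp add: mult.left_commute flip: mult.assoc)
    have "x < pi / 2" using that by simp
    note cs = cosh_sinh_ln_tan[OF that(1) this]
    have "sin (2 * x) > 0" using that by (intro sin_gt_zero) auto
    then show ?thesis
      unfolding H_def z_def sin_half_pi_plus_i cos_half_pi_plus_i cs F[OF that] U_def[symmetric]
      by (simp add: power2_eq_square ii)
  qed
  ultimately show ?thesis
    using has_integral_ln_tan_substitution[OF abs, of F] by (simp only: U_def)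
qed

section \<open>Zeta and beta values\<close>

lemma zeta_of_nat: "zeta (of_nat m) = (\<Sum>k. 1 / of_nat (Suc k) ^ m)"
  unfolding zeta_def by (intro suminf_cong) (simp add: powr_nat' del: of_nat_Suc)

text \<open>Since pi (r + 1/2) = (2r + 1) pi / 2, the series is (2 / pi)^m times the part of zeta
  over odd integers, and removing the even integers multiplies zeta by 1 - 2^-m.\<close>

lemma sum_half_odd_powers_zeta:
  assumes "m \<ge> 2"
  shows "(\<Sum>r. 1 ^ r / of_real (pi * (real r + 1 / 2)) ^ m) = (2 ^ m - 1) * zeta (of_nat m) / of_real pi ^ m"
proof -
  define a where "a = (\<lambda>k. 1 / complex_of_nat (Suc k) ^ m)"
  have "summable (\<lambda>k. norm (a k))"
  proof -
    have "summable (\<lambda>r. inverse (real (Suc r) ^ m))"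
      using assms by (subst summable_Suc_iff) (rule inverse_power_summable)
    then show ?thesis by (simp add: a_def norm_divide norm_power inverse_eq_divide del: of_nat_Suc)
  qed
  then have a: "a sums zeta (of_nat m)"
    using summable_norm_cancel[THEN summable_sums] by (simp add: zeta_of_nat a_def)
  \<comment> \<open>Indices are shifted by one against denominators: the even denominator 2k + 2
    sits at index 2k + 1, and \<open>a k / 2 ^ m\<close> is exactly that term.\<close>
  have "(\<lambda>k. sum a {k * 2..<k * 2 + 2} - a k / 2 ^ m) sums (zeta (of_nat m) - zeta (of_nat m) / 2 ^ m)"
    by (intro sums_diff sums_group sums_divide a) auto
  also have "(\<lambda>k. sum a {k * 2..<k * 2 + 2} - a k / 2 ^ m) = (\<lambda>k. a (2 * k))"
  proof
    fix k
    have "{k * 2..<k * 2 + 2} = {2 * k, Suc (2 * k)}" by auto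
    moreover have "a (Suc (2 * k)) = a k / 2 ^ m"
    proof -
      have "complex_of_nat (Suc (Suc (2 * k))) = 2 * of_nat (Suc k)" by simp
      then show ?thesis by (simp only: a_def power_mult_distrib) simp
    qed
    ultimately show "sum a {k * 2..<k * 2 + 2} - a k / 2 ^ m = a (2 * k)" by simp
  qed
  finally have "(\<lambda>k. (2 / of_real pi) ^ m * a (2 * k)) sums
      ((2 / of_real pi) ^ m * (zeta (of_nat m) - zeta (of_nat m) / 2 ^ m))"
    by (rule sums_mult)
  also have "(\<lambda>k. (2 / of_real pi) ^ m * a (2 * k)) = (\<lambda>r. 1 ^ r / of_real (pi * (real r + 1 / 2)) ^ m)"
  proof
    fix r
    have "complex_of_real (pi * (real r + 1 / 2)) = of_nat (Suc (2 * r)) / (2 / of_real pi)"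
      by (simp add: field_simps)
    then show "(2 / of_real pi) ^ m * a (2 * r) = 1 ^ r / of_real (pi * (real r + 1 / 2)) ^ m"
      by (simp only: a_def power_divide power_one) simp
  qed
  finally have "(\<Sum>r. 1 ^ r / of_real (pi * (real r + 1 / 2)) ^ m) =
      (2 / of_real pi) ^ m * (zeta (of_nat m) - zeta (of_nat m) / 2 ^ m)"
    by (rule sums_unique[symmetric])
  also have "\<dots> = (2 ^ m - 1) * zeta (of_nat m) / of_real pi ^ m"
    by (simp add: power_divide field_simps)
  finally show ?thesis .
qed

lemma sum_half_odd_powers_beta:
  assumes "m \<ge> 2"
  shows "(\<Sum>r. (-1) ^ r / of_real (pi * (real r + 1 / 2)) ^ m) = 2 ^ m * dirichlet_beta (of_nat m) / of_real pi ^ m"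
proof -
  define t where "t = (\<lambda>r. (-1) ^ r / complex_of_real (pi * (real r + 1 / 2)) ^ m)"
  have t: "summable t"
  proof (rule summable_norm_cancel)
    have "pi * (real r + 1 / 2) > 0" for r by (simp add: add_nonneg_pos)
    then have "(\<lambda>r. norm (t r)) = (\<lambda>r. 1 / (pi * (real r + 1 / 2)) ^ m)"
      unfolding t_def norm_divide norm_power norm_of_real by (simp only: abs_of_pos) simp
    then show "summable (\<lambda>r. norm (t r))"
      using summable_half_integer_powers[OF assms] by (simp only:)
  qed
  have "dirichlet_beta (of_nat m) = (\<Sum>r. (of_real pi / 2) ^ m * t r)"
    unfolding dirichlet_beta_def
  proof (rule suminf_cong)
    fix r
    have "complex_of_real (pi * (real r + 1 / 2)) = of_nat (2 * r + 1) * (of_real pi / 2)"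
      by (simp add: field_simps)
    moreover have "complex_of_nat (2 * r + 1) powr of_nat m = of_nat (2 * r + 1) ^ m"
      using assms by (intro powr_nat') auto
    ultimately show "(-1) ^ r / complex_of_nat (2 * r + 1) powr of_nat m = (of_real pi / 2) ^ m * t r"
      by (simp only: t_def power_mult_distrib) simp
  qed
  also have "\<dots> = (of_real pi / 2) ^ m * suminf t" by (rule suminf_mult[OF t])
  finally show ?thesis by (simp add: t_def power_divide)
qed

theorem proposition3p3:
  fixes n :: nat
  assumes "n \<ge> 1"
  shows "((\<lambda>x::real. complex_of_real (sin (4 * real n * x) / ln (tan x))) has_integral
            ((-1) ^ n / 2 * (\<Sum>p = 1..n. (2 ^ (2 * p + 1) - 1)
               * laurent_coeff_x (\<lambda>x. poly (cheb_U (2 * n - 1)) (1 / x) * Arcsin x ^ (2 * p))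
               * (zeta (of_nat (2 * p + 1)) / complex_of_real pi ^ (2 * p)))))
          {0..pi / 4}
       \<and> ((\<lambda>x::real. complex_of_real (cos ((4 * real n - 2) * x) / ln (tan x))) has_integral
            ((-1) ^ n * (\<Sum>p = 1..n. 2 ^ (2 * p - 1)
               * laurent_coeff_x (\<lambda>x. poly (cheb_U (2 * n - 2)) (1 / x) * Arcsin x ^ (2 * p - 1))
               * (dirichlet_beta (of_nat (2 * p)) / complex_of_real pi ^ (2 * p - 1)))))
          {0..pi / 4}"
proof -
  obtain q where n: "n = Suc q" using assms by (cases n) auto
  \<comment> \<open>With \<theta> = pi/2 - 2x this is the defining property of U_m, as sin 2x = cos
    \<theta> and cos 2x = sin \<theta>, which is positive on the range of x.\<close>
  have U: "poly (cheb_U m) (of_real (sin (2 * x))) * of_real (cos (2 * x)) =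
      complex_of_real (sin (real (m + 1) * (pi / 2 - 2 * x)))" if "0 < x" "x < pi / 4" for m x
  proof -
    define \<theta> where "\<theta> = pi / 2 - 2 * x"
    have "sin \<theta> = cos (2 * x)" "cos \<theta> = sin (2 * x)" by (simp_all add: \<theta>_def sin_diff cos_diff)
    moreover have "cos (2 * x) > 0" using that by (intro cos_gt_zero) auto
    moreover have "complex_of_nat (m + 1) * of_real \<theta> = of_real (real (m + 1) * \<theta>)" by simp
    ultimately show ?thesis
      using poly_cheb_U_cos[of "of_real \<theta>" m] unfolding \<theta>_def[symmetric]
      by (simp only: sin_of_real cos_of_real) simp
  qed
  have reindex: "(\<Sum>p = 1..n. f p) = (\<Sum>k\<le>q. f (Suc k))" for f :: "nat \<Rightarrow> complex"
    unfolding n by (simp only: One_nat_def sum.shift_bounds_cl_Suc_ivl atMost_atLeast0)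
  have "((\<lambda>x. of_real (sin (4 * real n * x)) / of_real (ln (tan x))) has_integral
      (- ((-1) ^ (n + 1)) / 2 * (\<Sum>k\<le>q. laurent_coeff_x (\<lambda>x. poly (cheb_U (3 + 2 * q - 2)) (1 / x) * Arcsin x ^ (3 + 2 * k - 1)) *
         (of_real pi * (\<Sum>r. 1 ^ r / of_real (pi * (real r + 1 / 2)) ^ (3 + 2 * k)))))) {0..pi / 4}"
  proof (rule sums_imp_has_integral_ln_tan[where P = per_pole])
    show "\<exists>g. g analytic_on {0} \<and> (\<forall>z. sin z \<noteq> 0 \<longrightarrow> per_pole m z = 1 / z ^ m + g z)" if "m \<ge> 1" for m
      using per_pole_near_0[OF that] by metis
    show "complex_of_real (sin (4 * real n * x)) = (-1) ^ (n + 1) * poly (cheb_U (3 + 2 * q - 2)) (of_real (sin (2 * x))) * of_real (cos (2 * x))"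
      if "0 < x" "x < pi / 4" for x
    proof -
      \<comment> \<open>The shift by n pi is the origin of the sign (-1)^(n+1) used for
        \<open>\<kappa>\<close>.\<close>
      have "real (3 + 2 * q - 2 + 1) * (pi / 2 - 2 * x) = real n * pi - 4 * real n * x"
        by (simp add: n algebra_simps)
      then have "sin (real (3 + 2 * q - 2 + 1) * (pi / 2 - 2 * x)) = (-1) ^ (n + 1) * sin (4 * real n * x)"
        by (simp add: sin_diff)
      then show ?thesis using U[OF that, of "3 + 2 * q - 2"] by (simp add: mult.assoc)
    qed
    show "(per_pole m has_field_derivative - of_nat m * per_pole (Suc m) z) (at z)"
      if "m \<ge> 1" "sin z \<noteq> 0" for m z
      by (rule has_field_derivative_per_pole[OF that(2,1)])
    show "(\<lambda>r. 1 ^ r * pole_diff (3 + 2 * k) (pi * (real r + 1 / 2)) u) sums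
        (\<i> ^ (3 + 2 * k) * per_pole (3 + 2 * k) (of_real pi / 2 + \<i> * of_real u))" if "u > 0" for k u
      by (rule per_pole_at_half_pi) (use that in auto)
  qed (auto simp: per_pole_3)
  moreover have "((\<lambda>x. of_real (cos ((4 * real n - 2) * x)) / of_real (ln (tan x))) has_integral
      (- ((-1) ^ (n + 1)) / 2 * (\<Sum>k\<le>q. laurent_coeff_x (\<lambda>x. poly (cheb_U (2 + 2 * q - 2)) (1 / x) * Arcsin x ^ (2 + 2 * k - 1)) *
         (of_real pi * (\<Sum>r. (-1) ^ r / of_real (pi * (real r + 1 / 2)) ^ (2 + 2 * k)))))) {0..pi / 4}"
  proof (rule sums_imp_has_integral_ln_tan[where P = alt_pole])
    show "\<exists>g. g analytic_on {0} \<and> (\<forall>z. sin z \<noteq> 0 \<longrightarrow> alt_pole m z = 1 / z ^ m + g z)" if "m \<ge> 1" for m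
      using alt_pole_near_0[OF that] by metis
    show "complex_of_real (cos ((4 * real n - 2) * x)) = (-1) ^ (n + 1) * poly (cheb_U (2 + 2 * q - 2)) (of_real (sin (2 * x))) * of_real (cos (2 * x))"
      if "0 < x" "x < pi / 4" for x
    proof -
      have "real (2 + 2 * q - 2 + 1) * (pi / 2 - 2 * x) = real n * pi - pi / 2 - (4 * real n - 2) * x"
        by (simp add: n algebra_simps)
      then have "sin (real (2 + 2 * q - 2 + 1) * (pi / 2 - 2 * x)) = (-1) ^ (n + 1) * cos ((4 * real n - 2) * x)"
        by (simp add: sin_diff cos_diff)
      then show ?thesis using U[OF that, of "2 + 2 * q - 2"] by (simp add: mult.assoc)
    qed
    show "(alt_pole m has_field_derivative - of_nat m * alt_pole (Suc m) z) (at z)"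
      if "m \<ge> 1" "sin z \<noteq> 0" for m z
      by (rule has_field_derivative_alt_pole[OF that(2,1)])
    show "(\<lambda>r. (-1) ^ r * pole_diff (2 + 2 * k) (pi * (real r + 1 / 2)) u) sums
        (\<i> ^ (2 + 2 * k) * alt_pole (2 + 2 * k) (of_real pi / 2 + \<i> * of_real u))" if "u > 0" for k u
      by (rule alt_pole_at_half_pi) (use that in auto)
  qed (auto simp: alt_pole_2)
  moreover have "- ((-1) ^ (n + 1)) / 2 * (\<Sum>k\<le>q. laurent_coeff_x (\<lambda>x. poly (cheb_U (3 + 2 * q - 2)) (1 / x) * Arcsin x ^ (3 + 2 * k - 1)) *
         (of_real pi * (\<Sum>r. 1 ^ r / of_real (pi * (real r + 1 / 2)) ^ (3 + 2 * k)))) =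
      (-1) ^ n / 2 * (\<Sum>p = 1..n. (2 ^ (2 * p + 1) - 1)
               * laurent_coeff_x (\<lambda>x. poly (cheb_U (2 * n - 1)) (1 / x) * Arcsin x ^ (2 * p))
               * (zeta (of_nat (2 * p + 1)) / complex_of_real pi ^ (2 * p)))"
  proof -
    have "laurent_coeff_x (\<lambda>x. poly (cheb_U (3 + 2 * q - 2)) (1 / x) * Arcsin x ^ (3 + 2 * k - 1)) *
         (of_real pi * (\<Sum>r. 1 ^ r / of_real (pi * (real r + 1 / 2)) ^ (3 + 2 * k))) =
        (2 ^ (2 * Suc k + 1) - 1)
               * laurent_coeff_x (\<lambda>x. poly (cheb_U (2 * n - 1)) (1 / x) * Arcsin x ^ (2 * Suc k))
               * (zeta (of_nat (2 * Suc k + 1)) / complex_of_real pi ^ (2 * Suc k))" for k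
    proof -
      have e: "3 + 2 * q - 2 = 2 * n - 1" "3 + 2 * k - 1 = 2 * Suc k" "3 + 2 * k = 2 * Suc k + 1"
        by (auto simp: n)
      have alg: "L * (complex_of_real pi * (A * Z / of_real pi ^ (2 * Suc k + 1))) = A * L * (Z / of_real pi ^ (2 * Suc k))"
        for A L Z by simp
      have S: "(\<Sum>r. 1 ^ r / of_real (pi * (real r + 1 / 2)) ^ (2 * Suc k + 1)) =
          (2 ^ (2 * Suc k + 1) - 1) * zeta (of_nat (2 * Suc k + 1)) / of_real pi ^ (2 * Suc k + 1)"
        by (rule sum_half_odd_powers_zeta) simp
      show ?thesis
        unfolding e(1,2) unfolding e(3) S by (rule alg)
    qed
    then show ?thesis unfolding reindex by simp
  qed
  moreover have "- ((-1) ^ (n + 1)) / 2 * (\<Sum>k\<le>q. laurent_coeff_x (\<lambda>x. poly (cheb_U (2 + 2 * q - 2)) (1 / x) * Arcsin x ^ (2 + 2 * k - 1)) *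
         (of_real pi * (\<Sum>r. (-1) ^ r / of_real (pi * (real r + 1 / 2)) ^ (2 + 2 * k)))) =
      (-1) ^ n * (\<Sum>p = 1..n. 2 ^ (2 * p - 1)
               * laurent_coeff_x (\<lambda>x. poly (cheb_U (2 * n - 2)) (1 / x) * Arcsin x ^ (2 * p - 1))
               * (dirichlet_beta (of_nat (2 * p)) / complex_of_real pi ^ (2 * p - 1)))"
  proof -
    \<comment> \<open>With p = k + 1 the beta series supplies 2^(2p); one factor 2 is split off to
      cancel the 1/2 of the prefactor.\<close>
    have "laurent_coeff_x (\<lambda>x. poly (cheb_U (2 + 2 * q - 2)) (1 / x) * Arcsin x ^ (2 + 2 * k - 1)) *
         (of_real pi * (\<Sum>r. (-1) ^ r / of_real (pi * (real r + 1 / 2)) ^ (2 + 2 * k))) =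
        2 * (2 ^ (2 * Suc k - 1)
               * laurent_coeff_x (\<lambda>x. poly (cheb_U (2 * n - 2)) (1 / x) * Arcsin x ^ (2 * Suc k - 1))
               * (dirichlet_beta (of_nat (2 * Suc k)) / complex_of_real pi ^ (2 * Suc k - 1)))" for k
    proof -
      have e: "2 + 2 * q - 2 = 2 * n - 2" "2 + 2 * k = 2 * Suc k" by (auto simp: n)
      show ?thesis
        unfolding e by (subst sum_half_odd_powers_beta) simp_all
    qed
    then have "(\<Sum>k\<le>q. laurent_coeff_x (\<lambda>x. poly (cheb_U (2 + 2 * q - 2)) (1 / x) * Arcsin x ^ (2 + 2 * k - 1)) *
         (of_real pi * (\<Sum>r. (-1) ^ r / of_real (pi * (real r + 1 / 2)) ^ (2 + 2 * k)))) =
        2 * (\<Sum>p = 1..n. 2 ^ (2 * p - 1)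
               * laurent_coeff_x (\<lambda>x. poly (cheb_U (2 * n - 2)) (1 / x) * Arcsin x ^ (2 * p - 1))
               * (dirichlet_beta (of_nat (2 * p)) / complex_of_real pi ^ (2 * p - 1)))"
      unfolding reindex sum_distrib_left by (intro sum.cong refl) simp_all
    then show ?thesis by simp
  qed
  ultimately show ?thesis by (simp only: of_real_divide)
qed

end
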